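(* Let $M_n$ ($n>3$) be an $n$-dimensional Kenmotsu manifold with structure $(\phi,\xi,\eta,g)$, admitting the semi-symmetric non-metric connection $\nabla$ given by $\nabla_XY=D^{g}_XY+g(\phi X,Y)\xi$, where $D^{g}$ is the Levi-Civita connection of $g$. Suppose $M_n$ is weakly symmetric with respect to $\nabla$; that is, there are $1$-forms $A,B,C,D$ and a vector field $\sigma$ on $M_n$ such that the curvature tensor $R$ of $\nabla$ satisfies $$(\nabla_XR)(Y,Z)W=A(X)R(Y,Z)W+B(Y)R(X,Z)W+C(Z)R(Y,X)W+D(W)R(Y,Z)X+g(R(Y,Z)W,X)\sigma$$ for all vector fields $X,Y,Z,W$. Then $A+C+D$ is everywhere zero on $M_n$. (Equivalently: there is no such weakly symmetric $M_n$ unless $A+C+D$ is everywhere zero.)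
   Context: Kenmotsu manifold: an $n$-dimensional smooth Riemannian manifold $(M_n,g)$ with a $1$-form $\eta$, a vector field $\xi$ and a $(1,1)$ tensor field $\phi$ such that for all vector fields $X,Y$: $\phi^2X=-X+\eta(X)\xi$, $\phi\xi=0$, $\eta(\phi X)=0$, $\eta(\xi)=1$, $g(\phi X,\phi Y)=g(X,Y)-\eta(X)\eta(Y)$ (hence $g(\xi,Y)=\eta(Y)$ and $g(\phi X,Y)=-g(X,\phi Y)$), and, with $D^{g}$ the Levi-Civita connection of $g$, $(D^{g}_X\phi)(Y)=g(\phi X,Y)\xi-\eta(Y)\phi X$ and $D^{g}_X\xi=X-\eta(X)\xi$. Semi-symmetric non-metric connection: the linear connection $\nabla_XY=D^{g}_XY+g(\phi X,Y)\xi$. Its torsion is $T(X,Y)=2g(\phi X,Y)\xi$, and $(\nabla_Xg)(Y,Z)=-\eta(Y)g(\phi X,Z)-\eta(Z)g(\phi X,Y)$. Its curvature tensor is $R(X,Y)Z=\nabla_X\nabla_YZ-\nabla_Y\nabla_XZ-\nabla_{[X,Y]}Z$, and $\nabla_XR$ denotes the usual covariant derivative of the tensor field $R$ with respect to $\nabla$. Weakly symmetric with respect to $\nabla$: a non-flat $n$-dimensional manifold ($n>3$) for which there are $1$-forms $A,B,C,D$ and a vector field $\sigma$ satisfying the displayed identity. Here $D$ is a $1$-form, not a connection. *)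

theory Defs
  imports "HOL-Analysis.Analysis" "HOL-Library.Function_Algebras"
begin

text \<open>Functions and operators on functions are added, subtracted and (functions only) multiplied
  pointwise, with the instances of Function_Algebras; in particular \<open>0\<close> is the zero function.\<close>

text \<open>For open \<open>S\<close> this is the class \<open>C\<^sup>k\<close> on \<open>S\<close>: the iterated directional derivatives of order
  less than \<open>k\<close> are Frechet differentiable, and those of order \<open>k\<close> are continuous.\<close>

primrec Ck_on :: "nat \<Rightarrow> 'b::euclidean_space set \<Rightarrow> ('b \<Rightarrow> 'c::real_normed_vector) \<Rightarrow> bool" where
  "Ck_on 0 S f \<longleftrightarrow> continuous_on S f"
| "Ck_on (Suc k) S f \<longleftrightarrow>
     (\<forall>x\<in>S. f differentiable (at x)) \<and> (\<forall>v. Ck_on k S (\<lambda>x. frechet_derivative f (at x) v))"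

definition smooth_on :: "'b::euclidean_space set \<Rightarrow> ('b \<Rightarrow> 'c::real_normed_vector) \<Rightarrow> bool" where
  "smooth_on S f \<longleftrightarrow> (\<forall>k. Ck_on k S f)"

text \<open>A chart is a pair \<open>(U, \<psi>)\<close>; only the values of \<open>\<psi>\<close> on \<open>U\<close> matter.\<close>

type_synonym ('a, 'n) chart = "'a set \<times> ('a \<Rightarrow> real ^ 'n)"

definition chart_inv :: "('a, 'n) chart \<Rightarrow> real ^ 'n \<Rightarrow> 'a" where
  "chart_inv c = inv_into (fst c) (snd c)"

definition is_chart :: "('a::topological_space, 'n::finite) chart \<Rightarrow> bool" where
  "is_chart c \<longleftrightarrow> open (fst c) \<and> open (snd c ` fst c) \<and>
     homeomorphism (fst c) (snd c ` fst c) (snd c) (chart_inv c)"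

definition smoothly_compatible ::
    "('a::topological_space, 'n::finite) chart \<Rightarrow> ('a, 'n) chart \<Rightarrow> bool" where
  "smoothly_compatible c d \<longleftrightarrow> smooth_on (snd c ` (fst c \<inter> fst d)) (snd d \<circ> chart_inv c)"

text \<open>The manifold is the whole type \<open>'a\<close>, which the sort constraint makes Hausdorff and second
  countable; its dimension is the cardinality of \<open>'n\<close>.  The atlas need not be maximal.\<close>

definition smooth_atlas ::
    "('a::{t2_space, second_countable_topology}, 'n::finite) chart set \<Rightarrow> bool" where
  "smooth_atlas \<A> \<longleftrightarrow> (\<Union>c\<in>\<A>. fst c) = UNIV \<and> (\<forall>c\<in>\<A>. is_chart c) \<and>
     (\<forall>c\<in>\<A>. \<forall>d\<in>\<A>. smoothly_compatible c d)"

definition smooth_functions ::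
    "('a::topological_space, 'n::finite) chart set \<Rightarrow> ('a \<Rightarrow> real) set" where
  "smooth_functions \<A> = {f. \<forall>c\<in>\<A>. smooth_on (snd c ` fst c) (f \<circ> chart_inv c)}"

text \<open>As in Helgason's \<^emph>\<open>Differential Geometry, Lie Groups, and Symmetric Spaces\<close>, smooth vector
  fields are the derivations of the algebra of smooth functions, and tensor fields are the maps
  on vector fields that are multilinear over that algebra.  A derivation is extended by \<open>0\<close> to
  functions that are not smooth, so that equality of vector fields is equality in HOL.
  The tangent vector \<open>X\<^sub>p\<close> is the functional \<open>\<lambda>f. X f p\<close>.\<close>

type_synonym 'a vfield = "('a \<Rightarrow> real) \<Rightarrow> ('a \<Rightarrow> real)"

definition vector_fields ::
    "('a::topological_space, 'n::finite) chart set \<Rightarrow> 'a vfield set" where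
  "vector_fields \<A> = {X.
     (\<forall>f\<in>smooth_functions \<A>. X f \<in> smooth_functions \<A>) \<and>
     (\<forall>f\<in>smooth_functions \<A>. \<forall>h\<in>smooth_functions \<A>. X (f + h) = X f + X h) \<and>
     (\<forall>f\<in>smooth_functions \<A>. \<forall>r. X (\<lambda>p. r * f p) = (\<lambda>p. r * X f p)) \<and>
     (\<forall>f\<in>smooth_functions \<A>. \<forall>h\<in>smooth_functions \<A>. X (f * h) = f * X h + h * X f) \<and>
     (\<forall>f. f \<notin> smooth_functions \<A> \<longrightarrow> X f = 0)}"

definition fscale :: "('a \<Rightarrow> real) \<Rightarrow> 'a vfield \<Rightarrow> 'a vfield" (infixr "\<odot>" 75) where
  "h \<odot> X = (\<lambda>f. h * X f)"

definition lie_bracket :: "'a vfield \<Rightarrow> 'a vfield \<Rightarrow> 'a vfield" where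
  "lie_bracket X Y = (\<lambda>f. X (Y f) - Y (X f))"

text \<open>The values of tensor fields and connections outside \<open>vector_fields \<A>\<close> are irrelevant and
  left unconstrained.\<close>

definition one_form ::
    "('a::topological_space, 'n::finite) chart set \<Rightarrow> ('a vfield \<Rightarrow> 'a \<Rightarrow> real) \<Rightarrow> bool" where
  "one_form \<A> \<alpha> \<longleftrightarrow>
     (\<forall>X\<in>vector_fields \<A>. \<alpha> X \<in> smooth_functions \<A>) \<and>
     (\<forall>X\<in>vector_fields \<A>. \<forall>Y\<in>vector_fields \<A>. \<alpha> (X + Y) = \<alpha> X + \<alpha> Y) \<and>
     (\<forall>h\<in>smooth_functions \<A>. \<forall>X\<in>vector_fields \<A>. \<alpha> (h \<odot> X) = h * \<alpha> X)"

definition tensor_11 ::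
    "('a::topological_space, 'n::finite) chart set \<Rightarrow> ('a vfield \<Rightarrow> 'a vfield) \<Rightarrow> bool" where
  "tensor_11 \<A> \<phi> \<longleftrightarrow>
     (\<forall>X\<in>vector_fields \<A>. \<phi> X \<in> vector_fields \<A>) \<and>
     (\<forall>X\<in>vector_fields \<A>. \<forall>Y\<in>vector_fields \<A>. \<phi> (X + Y) = \<phi> X + \<phi> Y) \<and>
     (\<forall>h\<in>smooth_functions \<A>. \<forall>X\<in>vector_fields \<A>. \<phi> (h \<odot> X) = h \<odot> \<phi> X)"

definition riemannian_metric ::
    "('a::topological_space, 'n::finite) chart set \<Rightarrow> ('a vfield \<Rightarrow> 'a vfield \<Rightarrow> 'a \<Rightarrow> real) \<Rightarrow> bool"
  where
  "riemannian_metric \<A> g \<longleftrightarrow>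
     (\<forall>X\<in>vector_fields \<A>. one_form \<A> (g X)) \<and>
     (\<forall>X\<in>vector_fields \<A>. \<forall>Y\<in>vector_fields \<A>. g X Y = g Y X) \<and>
     (\<forall>X\<in>vector_fields \<A>. \<forall>p. (\<exists>f\<in>smooth_functions \<A>. X f p \<noteq> 0) \<longrightarrow> g X X p > 0)"

type_synonym 'a conn = "'a vfield \<Rightarrow> 'a vfield \<Rightarrow> 'a vfield"

definition linear_connection ::
    "('a::topological_space, 'n::finite) chart set \<Rightarrow> 'a conn \<Rightarrow> bool" where
  "linear_connection \<A> \<Gamma> \<longleftrightarrow>
     (\<forall>X\<in>vector_fields \<A>. \<forall>Y\<in>vector_fields \<A>. \<Gamma> X Y \<in> vector_fields \<A>) \<and>
     (\<forall>X\<in>vector_fields \<A>. \<forall>Y\<in>vector_fields \<A>. \<forall>Z\<in>vector_fields \<A>.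
        \<Gamma> (X + Y) Z = \<Gamma> X Z + \<Gamma> Y Z \<and> \<Gamma> X (Y + Z) = \<Gamma> X Y + \<Gamma> X Z) \<and>
     (\<forall>h\<in>smooth_functions \<A>. \<forall>X\<in>vector_fields \<A>. \<forall>Y\<in>vector_fields \<A>.
        \<Gamma> (h \<odot> X) Y = h \<odot> \<Gamma> X Y \<and> \<Gamma> X (h \<odot> Y) = X h \<odot> Y + h \<odot> \<Gamma> X Y)"

definition levi_civita ::
    "('a::topological_space, 'n::finite) chart set \<Rightarrow> ('a vfield \<Rightarrow> 'a vfield \<Rightarrow> 'a \<Rightarrow> real)
      \<Rightarrow> 'a conn \<Rightarrow> bool" where
  "levi_civita \<A> g \<Gamma> \<longleftrightarrow> linear_connection \<A> \<Gamma> \<and>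
     (\<forall>X\<in>vector_fields \<A>. \<forall>Y\<in>vector_fields \<A>. \<Gamma> X Y - \<Gamma> Y X = lie_bracket X Y) \<and>
     (\<forall>X\<in>vector_fields \<A>. \<forall>Y\<in>vector_fields \<A>. \<forall>Z\<in>vector_fields \<A>.
        X (g Y Z) = g (\<Gamma> X Y) Z + g Y (\<Gamma> X Z))"

definition curvature :: "'a conn \<Rightarrow> 'a vfield \<Rightarrow> 'a vfield \<Rightarrow> 'a vfield \<Rightarrow> 'a vfield" where
  "curvature \<Gamma> X Y Z = \<Gamma> X (\<Gamma> Y Z) - \<Gamma> Y (\<Gamma> X Z) - \<Gamma> (lie_bracket X Y) Z"

definition cov_deriv_11 ::
    "'a conn \<Rightarrow> ('a vfield \<Rightarrow> 'a vfield) \<Rightarrow> 'a vfield \<Rightarrow> 'a vfield \<Rightarrow> 'a vfield" where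
  "cov_deriv_11 \<Gamma> \<phi> X Y = \<Gamma> X (\<phi> Y) - \<phi> (\<Gamma> X Y)"

definition cov_deriv_13 ::
    "'a conn \<Rightarrow> ('a vfield \<Rightarrow> 'a vfield \<Rightarrow> 'a vfield \<Rightarrow> 'a vfield)
      \<Rightarrow> 'a vfield \<Rightarrow> 'a vfield \<Rightarrow> 'a vfield \<Rightarrow> 'a vfield \<Rightarrow> 'a vfield" where
  "cov_deriv_13 \<Gamma> R X Y Z W =
     \<Gamma> X (R Y Z W) - R (\<Gamma> X Y) Z W - R Y (\<Gamma> X Z) W - R Y Z (\<Gamma> X W)"

definition kenmotsu_manifold ::
    "('a::{t2_space, second_countable_topology}, 'n::finite) chart set
      \<Rightarrow> ('a vfield \<Rightarrow> 'a vfield) \<Rightarrow> 'a vfield \<Rightarrow> ('a vfield \<Rightarrow> 'a \<Rightarrow> real)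
      \<Rightarrow> ('a vfield \<Rightarrow> 'a vfield \<Rightarrow> 'a \<Rightarrow> real) \<Rightarrow> 'a conn \<Rightarrow> bool" where
  "kenmotsu_manifold \<A> \<phi> \<xi> \<eta> g Dg \<longleftrightarrow>
     smooth_atlas \<A> \<and> riemannian_metric \<A> g \<and> levi_civita \<A> g Dg \<and>
     tensor_11 \<A> \<phi> \<and> \<xi> \<in> vector_fields \<A> \<and> one_form \<A> \<eta> \<and>
     \<phi> \<xi> = 0 \<and> \<eta> \<xi> = 1 \<and>
     (\<forall>X\<in>vector_fields \<A>. \<phi> (\<phi> X) = - X + \<eta> X \<odot> \<xi> \<and> \<eta> (\<phi> X) = 0) \<and>
     (\<forall>X\<in>vector_fields \<A>. \<forall>Y\<in>vector_fields \<A>. g (\<phi> X) (\<phi> Y) = g X Y - \<eta> X * \<eta> Y) \<and>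
     (\<forall>X\<in>vector_fields \<A>. \<forall>Y\<in>vector_fields \<A>.
        cov_deriv_11 Dg \<phi> X Y = g (\<phi> X) Y \<odot> \<xi> - \<eta> Y \<odot> \<phi> X) \<and>
     (\<forall>X\<in>vector_fields \<A>. Dg X \<xi> = X - \<eta> X \<odot> \<xi>)"

definition ssnm_connection ::
    "('a vfield \<Rightarrow> 'a vfield) \<Rightarrow> 'a vfield \<Rightarrow> ('a vfield \<Rightarrow> 'a vfield \<Rightarrow> 'a \<Rightarrow> real)
      \<Rightarrow> 'a conn \<Rightarrow> 'a conn" where
  "ssnm_connection \<phi> \<xi> g Dg X Y = Dg X Y + g (\<phi> X) Y \<odot> \<xi>"

definition weakly_symmetric ::
    "('a::{t2_space, second_countable_topology}, 'n::finite) chart set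
      \<Rightarrow> ('a vfield \<Rightarrow> 'a vfield \<Rightarrow> 'a \<Rightarrow> real) \<Rightarrow> 'a conn
      \<Rightarrow> ('a vfield \<Rightarrow> 'a \<Rightarrow> real) \<Rightarrow> ('a vfield \<Rightarrow> 'a \<Rightarrow> real)
      \<Rightarrow> ('a vfield \<Rightarrow> 'a \<Rightarrow> real) \<Rightarrow> ('a vfield \<Rightarrow> 'a \<Rightarrow> real) \<Rightarrow> 'a vfield \<Rightarrow> bool" where
  "weakly_symmetric \<A> g \<Gamma> A B C D \<sigma> \<longleftrightarrow>
     (\<exists>X\<in>vector_fields \<A>. \<exists>Y\<in>vector_fields \<A>. \<exists>Z\<in>vector_fields \<A>. curvature \<Gamma> X Y Z \<noteq> 0) \<and>
     one_form \<A> A \<and> one_form \<A> B \<and> one_form \<A> C \<and> one_form \<A> D \<and> \<sigma> \<in> vector_fields \<A> \<and>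
     (\<forall>X\<in>vector_fields \<A>. \<forall>Y\<in>vector_fields \<A>. \<forall>Z\<in>vector_fields \<A>. \<forall>W\<in>vector_fields \<A>.
        cov_deriv_13 \<Gamma> (curvature \<Gamma>) X Y Z W =
          A X \<odot> curvature \<Gamma> Y Z W + B Y \<odot> curvature \<Gamma> X Z W + C Z \<odot> curvature \<Gamma> Y X W
          + D W \<odot> curvature \<Gamma> Y Z X + g (curvature \<Gamma> Y Z W) X \<odot> \<sigma>)"

end

theory Submission
  imports Defs
begin

text \<open>Write \<open>\<omega>(X, Y) = g(\<phi>X, Y)\<close>.  A direct computation gives
  \<open>R(Y, Z)\<xi> = \<eta>(Y)Z - \<eta>(Z)Y + 2\<omega>(Y, Z)\<xi>\<close> and
  \<open>R(\<xi>, Z)W = \<eta>(W)Z + (\<omega>(Z, W) - g(Z, W))\<xi>\<close>.  Inserting \<open>\<xi>\<close> into two or three of the slots of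
  the weak symmetry identity and pairing with a horizontal field \<open>V\<close> (one with \<open>\<eta>(V) = 0\<close>) makes
  its left-hand side vanish; for horizontal \<open>X, Y, Z, W\<close> this leaves
  \<open>(A + C + D)(\<xi>) g(Y, V) = 0\<close>, \<open>A(X) g(Z, V) + C(Z) g(X, V) + g(X, Z) g(\<sigma>, V) = 0\<close> and
  \<open>D(W) g(Z, V) + (\<omega>(Z, W) - g(Z, W)) g(\<sigma>, V) = 0\<close>.
  At a point \<open>p\<close>, testing with a horizontal field \<open>Y\<close> not vanishing at \<open>p\<close> and with \<open>\<phi>Y\<close> shows that
  \<open>A\<close>, \<open>C\<close> and \<open>D\<close> vanish on horizontal fields and that \<open>A + C + D\<close> vanishes on \<open>\<xi>\<close>.  As vector
  fields are global derivations, the existence of such a \<open>Y\<close> needs bump functions.\<close>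

section \<open>Functions of class \<open>C\<^sup>k\<close>\<close>

lemma frechet_derivative_eqI:
  "(f has_derivative f') (at x) \<Longrightarrow> frechet_derivative f (at x) v = f' v"
  by (metis frechet_derivative_at)

text \<open>A Frechet derivative at a point of an open set depends only on nearby values, so
  functions equal on \<open>S\<close> share all directional derivatives there. Expressions in charts
  are simplified this way, as they have a useful form only on the chart image.\<close>

lemma Ck_on_cong:
  assumes "open S" "\<And>x. x \<in> S \<Longrightarrow> f x = g x"
  shows "Ck_on k S f \<longleftrightarrow> Ck_on k S g"
  using assms(2)
proof (induction k arbitrary: f g)
  case 0
  then show ?case by (auto intro: continuous_on_cong)
next
  case (Suc k)
  have hd: "(f has_derivative F) (at x) \<longleftrightarrow> (g has_derivative F) (at x)" if "x \<in> S" for x F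
    using has_derivative_transform_within_open[of f F x UNIV S g]
      has_derivative_transform_within_open[of g F x UNIV S f] assms(1) that Suc.prems by auto
  then have "f differentiable (at x) \<longleftrightarrow> g differentiable (at x)"
      "frechet_derivative f (at x) = frechet_derivative g (at x)" if "x \<in> S" for x
    using that by (simp_all add: differentiable_def frechet_derivative_def)
  moreover from this have "Ck_on k S (\<lambda>x. frechet_derivative f (at x) v)
      \<longleftrightarrow> Ck_on k S (\<lambda>x. frechet_derivative g (at x) v)" for v
    by (intro Suc.IH) simp
  ultimately show ?case by simp
qed

lemma Ck_on_subset: "Ck_on k S f \<Longrightarrow> T \<subseteq> S \<Longrightarrow> Ck_on k T f"
  by (induction k arbitrary: f) (auto intro: continuous_on_subset)

text \<open>Differentiability is a pointwise condition; openness enters only at order 0, where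
  continuity has to be glued.\<close>

lemma Ck_on_Un:
  assumes "open S" "open T" "Ck_on k S f" "Ck_on k T f"
  shows "Ck_on k (S \<union> T) f"
  using assms(3,4)
  by (induction k arbitrary: f) (auto intro: continuous_on_open_Un assms(1,2))

lemma Ck_on_SucD: "Ck_on (Suc k) S f \<Longrightarrow> Ck_on k S f"
proof (induction k arbitrary: f)
  case 0
  then show ?case
    by (auto intro!: continuous_at_imp_continuous_on differentiable_imp_continuous_within)
next
  case (Suc k)
  then show ?case by (metis Ck_on.simps(2))
qed

text \<open>Replaces the chosen \<open>frechet_derivative\<close> by an explicit formula
  \<open>f'\<close>, so that each closure proof below only needs the corresponding differentiation
  rule and the induction hypothesis.\<close>

lemma Ck_on_SucI:
  assumes "open S" "\<And>x. x \<in> S \<Longrightarrow> (f has_derivative f' x) (at x)"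
    "\<And>v. Ck_on k S (\<lambda>x. f' x v)"
  shows "Ck_on (Suc k) S f"
proof -
  have "Ck_on k S (\<lambda>x. frechet_derivative f (at x) v)" for v
    using assms(2,3) Ck_on_cong[OF assms(1), of "\<lambda>x. frechet_derivative f (at x) v" "\<lambda>x. f' x v" k]
    by (simp add: frechet_derivative_eqI)
  then show ?thesis using assms(2) by (auto simp: differentiable_def)
qed

lemma Ck_on_Suc_has_derivative:
  "Ck_on (Suc k) S f \<Longrightarrow> x \<in> S \<Longrightarrow> (f has_derivative frechet_derivative f (at x)) (at x)"
  by (simp add: frechet_derivative_works)

lemma Ck_on_Suc_derivative: "Ck_on (Suc k) S f \<Longrightarrow> Ck_on k S (\<lambda>x. frechet_derivative f (at x) v)"
  by simp

lemma Ck_on_const: "Ck_on k S (\<lambda>x. c)"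
proof (induction k arbitrary: c)
  case (Suc k)
  have "frechet_derivative (\<lambda>x::'a. c) (at x) = (\<lambda>v. 0)" for x
    by (rule frechet_derivative_at[symmetric]) simp
  with Suc show ?case by simp
qed simp

lemma Ck_on_bounded_linear:
  assumes "open S" "bounded_linear L" "Ck_on k S f"
  shows "Ck_on k S (\<lambda>x. L (f x))"
  using assms(3)
proof (induction k arbitrary: f)
  case 0
  then show ?case using bounded_linear.continuous_on[OF assms(2)] by simp
next
  case (Suc k)
  define f' where "f' x = frechet_derivative f (at x)" for x
  note f' = Ck_on_Suc_has_derivative[OF Suc.prems, folded f'_def]
    Ck_on_Suc_derivative[OF Suc.prems, folded f'_def]
  show ?case
    by (rule Ck_on_SucI[OF assms(1), where f' = "\<lambda>x v. L (f' x v)"])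
      (auto intro: bounded_linear.has_derivative[OF assms(2)] f' Suc.IH)
qed

lemma Ck_on_ident: "open S \<Longrightarrow> Ck_on k S (\<lambda>x. x)"
proof (cases k)
  case (Suc j)
  assume "open S"
  then show ?thesis unfolding Suc
    by (rule Ck_on_SucI[where f' = "\<lambda>x v. v"]) (auto intro: Ck_on_const derivative_eq_intros)
qed simp

lemma Ck_on_add:
  assumes "open S" "Ck_on k S f" "Ck_on k S g"
  shows "Ck_on k S (\<lambda>x. f x + g x)"
  using assms(2,3)
proof (induction k arbitrary: f g)
  case 0
  then show ?case by (simp add: continuous_on_add)
next
  case (Suc k)
  define f' where "f' x = frechet_derivative f (at x)" for x
  note f' = Ck_on_Suc_has_derivative[OF Suc.prems(1), folded f'_def]
    Ck_on_Suc_derivative[OF Suc.prems(1), folded f'_def]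
  define g' where "g' x = frechet_derivative g (at x)" for x
  note g' = Ck_on_Suc_has_derivative[OF Suc.prems(2), folded g'_def]
    Ck_on_Suc_derivative[OF Suc.prems(2), folded g'_def]
  show ?case
    by (rule Ck_on_SucI[OF assms(1), where f' = "\<lambda>x v. f' x v + g' x v"])
      (simp_all add: has_derivative_add f' g' Suc.IH del: Ck_on.simps)
qed

lemma Ck_on_sum:
  assumes "open S" "finite I" "\<And>i. i \<in> I \<Longrightarrow> Ck_on k S (f i)"
  shows "Ck_on k S (\<lambda>x. \<Sum>i\<in>I. f i x)"
  using assms(2,3) by (induction I) (auto intro: Ck_on_const Ck_on_add[OF assms(1)])

lemma Ck_on_scaleR:
  fixes f :: "'b::euclidean_space \<Rightarrow> real"
  assumes "open S" "Ck_on k S f" "Ck_on k S g"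
  shows "Ck_on k S (\<lambda>x. f x *\<^sub>R g x)"
  using assms(2,3)
proof (induction k arbitrary: f g)
  case 0
  then show ?case by (simp add: continuous_on_scaleR)
next
  case (Suc k)
  define f' where "f' x = frechet_derivative f (at x)" for x
  note f' = Ck_on_Suc_has_derivative[OF Suc.prems(1), folded f'_def]
    Ck_on_Suc_derivative[OF Suc.prems(1), folded f'_def]
  define g' where "g' x = frechet_derivative g (at x)" for x
  note g' = Ck_on_Suc_has_derivative[OF Suc.prems(2), folded g'_def]
    Ck_on_Suc_derivative[OF Suc.prems(2), folded g'_def]
  show ?case
    by (rule Ck_on_SucI[OF assms(1), where f' = "\<lambda>x v. f x *\<^sub>R g' x v + f' x v *\<^sub>R g x"])
      (simp_all add: has_derivative_scaleR Ck_on_add[OF assms(1)] f' g' Suc.IH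
        Ck_on_SucD[OF Suc.prems(1)] Ck_on_SucD[OF Suc.prems(2)] del: Ck_on.simps)
qed

lemma Ck_on_mult:
  fixes f g :: "'b::euclidean_space \<Rightarrow> real"
  shows "open S \<Longrightarrow> Ck_on k S f \<Longrightarrow> Ck_on k S g \<Longrightarrow> Ck_on k S (\<lambda>x. f x * g x)"
  using Ck_on_scaleR[of S k f g] unfolding real_scaleR_def .

lemma Ck_on_compose:
  fixes h :: "'b::euclidean_space \<Rightarrow> 'c::euclidean_space" and f :: "'c \<Rightarrow> 'd::real_normed_vector"
  assumes "open S" "h ` S \<subseteq> T" "Ck_on k S h" "Ck_on k T f"
  shows "Ck_on k S (\<lambda>x. f (h x))"
  using assms(3,4)
proof (induction k arbitrary: f)
  case 0
  then show ?case using continuous_on_compose2[OF _ _ assms(2), of f] by (simp del: o_apply)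
next
  case (Suc k)
  define f' where "f' x = frechet_derivative f (at x)" for x
  note f' = Ck_on_Suc_has_derivative[OF Suc.prems(2), folded f'_def]
    Ck_on_Suc_derivative[OF Suc.prems(2), folded f'_def]
  define h' where "h' x = frechet_derivative h (at x)" for x
  note h' = Ck_on_Suc_has_derivative[OF Suc.prems(1), folded h'_def]
    Ck_on_Suc_derivative[OF Suc.prems(1), folded h'_def]
  \<comment> \<open>In the chain rule, \<open>f' (h x) (h' x v)\<close> depends on \<open>x\<close>
    also through the direction, while the induction hypothesis covers fixed directions only.
    Expanding \<open>h' x v\<close> in the standard basis separates the two dependences.\<close>
  have "((\<lambda>x. f (h x)) has_derivative (\<lambda>v. \<Sum>b\<in>Basis. (h' x v \<bullet> b) *\<^sub>R f' (h x) b)) (at x)"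
    if "x \<in> S" for x
  proof -
    have fx: "(f has_derivative f' (h x)) (at (h x))" using that assms(2) f' by auto
    have lin: "linear (f' (h x))" using fx has_derivative_linear by blast
    have "f' (h x) (h' x v) = (\<Sum>b\<in>Basis. (h' x v \<bullet> b) *\<^sub>R f' (h x) b)" for v
    proof -
      have "f' (h x) (h' x v) = f' (h x) (\<Sum>b\<in>Basis. (h' x v \<bullet> b) *\<^sub>R b)"
        by (simp add: euclidean_representation)
      also have "\<dots> = (\<Sum>b\<in>Basis. (h' x v \<bullet> b) *\<^sub>R f' (h x) b)"
        using lin by (simp add: linear_sum linear_cmul)
      finally show ?thesis .
    qed
    with has_derivative_compose[OF h'(1)[OF that] fx] show ?thesis by simp
  qed
  then show ?case
  proof (rule Ck_on_SucI[OF assms(1)])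
    show "Ck_on k S (\<lambda>x. \<Sum>b\<in>Basis. (h' x v \<bullet> b) *\<^sub>R f' (h x) b)" for v
      by (rule Ck_on_sum[OF assms(1)], simp, rule Ck_on_scaleR[OF assms(1)])
        (rule Ck_on_bounded_linear[OF assms(1) bounded_linear_inner_left h'(2)],
          rule Suc.IH[OF Ck_on_SucD[OF Suc.prems(1)] f'(2)])
  qed
qed

section \<open>Bump functions\<close>

text \<open>The family is closed under differentiation up to linear combinations.\<close>

definition flat_exp :: "nat \<Rightarrow> real \<Rightarrow> real" where
  "flat_exp n x = (if x > 0 then inverse x ^ n * exp (- inverse x) else 0)"

text \<open>For \<open>y = 1 / x\<close>, the exponential series dominates its single term of degree
  \<open>n + 2\<close>, which gives \<open>y ^ (n + 2) \<le> fact (n + 2) * exp y\<close>. The two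
  powers beyond \<open>n\<close> leave a quadratic bound, enough for a zero derivative at the
  origin.\<close>

lemma flat_exp_bound: "\<bar>flat_exp n x\<bar> \<le> fact (n + 2) * x\<^sup>2"
proof (cases "x > 0")
  case True
  define y where "y = inverse x"
  have y: "y > 0" using True by (simp add: y_def)
  have "(\<lambda>m. y ^ m /\<^sub>R fact m) sums exp y" by (rule exp_converges)
  then have "(\<Sum>m\<in>{n + 2}. y ^ m /\<^sub>R fact m) \<le> exp y"
    using y by (intro sum_le_suminf[THEN order_trans]) (auto simp: sums_iff)
  then have *: "y ^ (n + 2) \<le> fact (n + 2) * exp y"
    using mult_left_mono[of _ _ "fact (n + 2)"] by (fastforce simp del: fact_Suc simp: mult.assoc[symmetric])
  have "y ^ n * exp (- y) = y ^ (n + 2) * (exp (- y) * x\<^sup>2)"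
    using True by (simp add: y_def power_add power2_eq_square field_simps)
  also have "\<dots> \<le> fact (n + 2) * exp y * (exp (- y) * x\<^sup>2)"
    by (rule mult_right_mono[OF *]) simp
  also have "\<dots> = fact (n + 2) * x\<^sup>2"
    by (simp add: exp_minus del: fact_Suc)
  finally show ?thesis using True y by (simp add: flat_exp_def y_def del: fact_Suc)
qed (simp add: flat_exp_def)

lemma flat_exp_deriv:
  "(flat_exp n has_real_derivative (flat_exp (n + 2) x - real n * flat_exp (n + 1) x)) (at x)"
proof -
  consider "x < 0" | "x > 0" | "x = 0" by linarith
  then show ?thesis
  proof cases
    case 1
    have "((\<lambda>x. 0) has_real_derivative 0) (at x)" by simp
    then have "(flat_exp n has_real_derivative 0) (at x)"
      by (rule DERIV_cong_ev[THEN iffD1, rotated -1])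
        (use 1 in \<open>auto simp: flat_exp_def eventually_nhds intro!: exI[of _ "{..<0}"]\<close>)
    with 1 show ?thesis by (simp add: flat_exp_def)
  next
    case 2
    have "((\<lambda>x. inverse x ^ n * exp (- inverse x)) has_real_derivative
        (flat_exp (n + 2) x - real n * flat_exp (n + 1) x)) (at x)"
      using 2 by (auto intro!: derivative_eq_intros simp: flat_exp_def field_simps)
        (cases n; simp add: field_simps power2_eq_square)
    then show ?thesis
      by (rule DERIV_cong_ev[THEN iffD1, rotated -1])
        (use 2 in \<open>auto simp: flat_exp_def eventually_nhds intro!: exI[of _ "{0<..}"]\<close>)
  next
    case 3
    \<comment> \<open>This is the difference quotient at 0, since \<open>flat_exp n 0 = 0\<close>;
      the quadratic bound squeezes it. The claimed derivative is 0 here as well.\<close>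
    have "((\<lambda>y. flat_exp n y / y) \<longlongrightarrow> 0) (at 0)"
    proof (rule tendsto_rabs_zero_cancel, rule tendsto_sandwich[where f = "\<lambda>_. 0"])
      show "\<forall>\<^sub>F y in at 0. \<bar>flat_exp n y / y\<bar> \<le> fact (n + 2) * \<bar>y\<bar>"
      proof (rule eventually_at_filter[THEN iffD2, OF always_eventually], intro allI impI)
        fix y :: real
        assume "y \<noteq> 0"
        have "\<bar>flat_exp n y\<bar> / \<bar>y\<bar> \<le> fact (n + 2) * y\<^sup>2 / \<bar>y\<bar>"
          by (rule divide_right_mono[OF flat_exp_bound]) simp
        also have "\<dots> = fact (n + 2) * \<bar>y\<bar>"
          using \<open>y \<noteq> 0\<close> by (cases "y > 0") (simp_all add: power2_eq_square del: fact_Suc)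
        finally show "\<bar>flat_exp n y / y\<bar> \<le> fact (n + 2) * \<bar>y\<bar>" by (simp del: fact_Suc)
      qed
      show "((\<lambda>y. fact (n + 2) * \<bar>y\<bar>) \<longlongrightarrow> (0::real)) (at 0)"
        by (auto intro!: tendsto_eq_intros)
    qed auto
    then show ?thesis unfolding 3 by (simp add: DERIV_def flat_exp_def)
  qed
qed

text \<open>The derivative involves the members \<open>n + 1\<close> and \<open>n + 2\<close> of the
  family, so the induction on \<open>k\<close> has to hold for all \<open>n\<close> at once.\<close>

lemma Ck_on_flat_exp: "Ck_on k UNIV (flat_exp n)"
proof (induction k arbitrary: n)
  case 0
  show ?case
    using DERIV_isCont[OF flat_exp_deriv] by (simp add: continuous_at_imp_continuous_on)
next
  case (Suc k)
  show ?case
  proof (rule Ck_on_SucI)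
    show "(flat_exp n has_derivative (\<lambda>v. v * (flat_exp (n + 2) x + - real n * flat_exp (n + 1) x))) (at x)" for x
      using flat_exp_deriv[of n x] by (simp add: has_field_derivative_def mult.commute[of _ "_ - _"] mult_commute_abs)
    show "Ck_on k UNIV (\<lambda>x. v * (flat_exp (n + 2) x + - real n * flat_exp (n + 1) x))" for v
      by (intro Ck_on_mult Ck_on_add Ck_on_const Suc.IH) auto
  qed auto
qed

lemma smooth_bump_exists:
  fixes x0 :: "'b::euclidean_space"
  assumes "open U" "x0 \<in> U"
  obtains \<beta> :: "'b \<Rightarrow> real" and K where "smooth_on UNIV \<beta>" "compact K" "K \<subseteq> U"
    "\<And>x. x \<notin> K \<Longrightarrow> \<beta> x = 0" "\<beta> x0 > 0"
proof -
  obtain r where r: "r > 0" "cball x0 r \<subseteq> U"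
    using assms open_contains_cball by blast
  \<comment> \<open>The argument of \<open>flat_exp 0\<close> is positive exactly inside the ball of
    radius \<open>r\<close>, so the closed ball can serve as \<open>K\<close>. It is built from sums
    and products alone, to which the closure lemmas apply.\<close>
  define \<beta> where "\<beta> = (\<lambda>x. flat_exp 0 (r\<^sup>2 + (-1) * ((x + - x0) \<bullet> (x + - x0))))"
  have "Ck_on k UNIV (\<lambda>x. (x + - x0) \<bullet> b)" for k b
    by (rule Ck_on_bounded_linear[OF open_UNIV bounded_linear_inner_left])
      (rule Ck_on_add[OF open_UNIV Ck_on_ident[OF open_UNIV] Ck_on_const])
  then have "Ck_on k UNIV (\<lambda>x. \<Sum>b\<in>Basis. ((x + - x0) \<bullet> b) * ((x + - x0) \<bullet> b))" for k
    by (intro Ck_on_sum[OF open_UNIV finite_Basis] Ck_on_mult[OF open_UNIV])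
  moreover have "(\<lambda>x. (x + - x0) \<bullet> (x + - x0))
      = (\<lambda>x. \<Sum>b\<in>Basis. ((x + - x0) \<bullet> b) * ((x + - x0) \<bullet> b))"
    by (rule ext, rule euclidean_inner)
  ultimately have "Ck_on k UNIV (\<lambda>x. (x + - x0) \<bullet> (x + - x0))" for k
    by (simp only:)
  from Ck_on_add[OF open_UNIV Ck_on_const[of _ _ "r\<^sup>2"] Ck_on_mult[OF open_UNIV Ck_on_const[of _ _ "-1"] this]]
  have "Ck_on k UNIV \<beta>" for k
    unfolding \<beta>_def by (rule Ck_on_compose[OF open_UNIV subset_UNIV _ Ck_on_flat_exp])
  moreover have "\<beta> x = 0" if "x \<notin> cball x0 r" for x
  proof -
    have "r\<^sup>2 \<le> (norm (x - x0))\<^sup>2"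
      using that r by (intro power_mono) (auto simp: dist_norm norm_minus_commute)
    moreover have "(x + - x0) \<bullet> (x + - x0) = (norm (x - x0))\<^sup>2"
      by (simp add: power2_norm_eq_inner)
    ultimately show ?thesis by (simp add: \<beta>_def flat_exp_def)
  qed
  moreover have "\<beta> x0 > 0" using r by (simp add: \<beta>_def flat_exp_def)
  ultimately show thesis
    using that[of \<beta> "cball x0 r"] r by (auto simp: smooth_on_def)
qed

section \<open>Smooth functions and vector fields\<close>

lemma chart_inv_snd: "is_chart c \<Longrightarrow> q \<in> fst c \<Longrightarrow> chart_inv c (snd c q) = q"
  by (simp add: is_chart_def homeomorphism_def)

lemma snd_chart_inv: "x \<in> snd c ` fst c \<Longrightarrow> snd c (chart_inv c x) = x"
  by (simp add: chart_inv_def f_inv_into_f)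

lemma chart_inv_mem: "x \<in> snd c ` fst c \<Longrightarrow> chart_inv c x \<in> fst c"
  by (simp add: chart_inv_def inv_into_into)

lemma open_chart_image: "is_chart c \<Longrightarrow> open (snd c ` fst c)"
  by (simp add: is_chart_def)

lemma open_chart_image_subset:
  assumes "is_chart c" "open V" "V \<subseteq> fst c"
  shows "open (snd c ` V)"
proof -
  have "openin (top_of_set (snd c ` fst c)) (snd c ` V)"
    using assms by (intro homeomorphism_imp_open_map) (auto simp: is_chart_def intro: open_openin_trans)
  then show ?thesis using open_chart_image[OF assms(1)] openin_open_trans by blast
qed

lemma smooth_functions_iff:
  "f \<in> smooth_functions \<A> \<longleftrightarrow> (\<forall>c\<in>\<A>. \<forall>k. Ck_on k (snd c ` fst c) (\<lambda>x. f (chart_inv c x)))"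
  by (simp add: smooth_functions_def smooth_on_def o_def)

lemma smooth_atlas_chart: "smooth_atlas \<A> \<Longrightarrow> c \<in> \<A> \<Longrightarrow> is_chart c"
  by (simp add: smooth_atlas_def)

lemma smooth_functions_const: "(\<lambda>p. r) \<in> smooth_functions \<A>"
  by (simp add: smooth_functions_iff Ck_on_const)

lemma smooth_functions_add:
  assumes "smooth_atlas \<A>" "f \<in> smooth_functions \<A>" "h \<in> smooth_functions \<A>"
  shows "f + h \<in> smooth_functions \<A>"
  unfolding smooth_functions_iff plus_fun_def
proof (intro ballI allI)
  fix c k assume c: "c \<in> \<A>"
  show "Ck_on k (snd c ` fst c) (\<lambda>x. f (chart_inv c x) + h (chart_inv c x))"
    using assms(2,3) c unfolding smooth_functions_iff
    by (intro Ck_on_add open_chart_image[OF smooth_atlas_chart[OF assms(1) c]]) blast+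
qed

lemma smooth_functions_mult:
  assumes "smooth_atlas \<A>" "f \<in> smooth_functions \<A>" "h \<in> smooth_functions \<A>"
  shows "f * h \<in> smooth_functions \<A>"
  unfolding smooth_functions_iff times_fun_def
proof (intro ballI allI)
  fix c k assume c: "c \<in> \<A>"
  show "Ck_on k (snd c ` fst c) (\<lambda>x. f (chart_inv c x) * h (chart_inv c x))"
    using assms(2,3) c unfolding smooth_functions_iff
    by (intro Ck_on_mult open_chart_image[OF smooth_atlas_chart[OF assms(1) c]]) blast+
qed

section \<open>Extension by zero, and a frame at a point made of global vector fields\<close>

definition extend_by_zero :: "('a, 'n) chart \<Rightarrow> (real ^ 'n \<Rightarrow> real) \<Rightarrow> 'a \<Rightarrow> real" where
  "extend_by_zero c u = (\<lambda>q. if q \<in> fst c then u (snd c q) else 0)"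

text \<open>Seen in any chart \<open>d\<close>, the function is covered by two open pieces: on the
  overlap with \<open>c\<close> it is \<open>u\<close> after a smooth transition map, and off the
  preimage \<open>L\<close> of \<open>K\<close> it is zero.\<close>

lemma extend_by_zero_smooth:
  fixes \<A> :: "('a::{t2_space, second_countable_topology}, 'n::finite) chart set"
  assumes \<A>: "smooth_atlas \<A>" and c: "c \<in> \<A>"
    and K: "compact K" "K \<subseteq> snd c ` fst c"
    and u: "\<And>k. Ck_on k (snd c ` fst c) u" "\<And>x. x \<in> snd c ` fst c - K \<Longrightarrow> u x = 0"
  shows "extend_by_zero c u \<in> smooth_functions \<A>"
  unfolding smooth_functions_iff
proof (intro ballI allI)
  fix d k
  assume d: "d \<in> \<A>"
  note ch = smooth_atlas_chart[OF \<A> c] smooth_atlas_chart[OF \<A> d]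
  define L where "L = chart_inv c ` K"
  have "continuous_on K (chart_inv c)"
    using ch(1) K(2) by (auto simp: is_chart_def homeomorphism_def intro: continuous_on_subset)
  \<comment> \<open>The Hausdorff property enters here: \<open>L\<close> is a continuous image of a
    compact set, hence compact and therefore closed.\<close>
  then have "closed L"
    unfolding L_def using K(1) compact_continuous_image compact_imp_closed by blast
  define P Q where "P = snd d ` (fst d \<inter> fst c)" and "Q = snd d ` (fst d - L)"
  have op: "open (fst d)" "open (fst c)" using ch by (auto simp: is_chart_def)
  have oP: "open P" and oQ: "open Q"
    unfolding P_def Q_def using op \<open>closed L\<close>
    by (intro open_chart_image_subset[OF ch(2)]; blast intro: open_Int open_Diff)+
  have "L \<subseteq> fst c"
    unfolding L_def using chart_inv_mem[OF subsetD[OF K(2)]] by (rule image_subsetI)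
  then have PQ: "snd d ` fst d = P \<union> Q"
    unfolding P_def Q_def image_Un[symmetric] by (intro arg_cong[where f = "image (snd d)"]) blast
  let ?f = "\<lambda>x. extend_by_zero c u (chart_inv d x)"
  have "smoothly_compatible d c" using \<A> c d by (simp add: smooth_atlas_def)
  then have tr: "Ck_on k P (\<lambda>x. snd c (chart_inv d x))"
    by (simp add: smoothly_compatible_def smooth_on_def P_def o_def)
  have dP: "chart_inv d x \<in> fst c" if "x \<in> P" for x
    using that ch(2) by (auto simp: P_def chart_inv_snd)
  then have img: "(\<lambda>x. snd c (chart_inv d x)) ` P \<subseteq> snd c ` fst c" by auto
  have "Ck_on k P ?f \<longleftrightarrow> Ck_on k P (\<lambda>x. u (snd c (chart_inv d x)))"
    by (rule Ck_on_cong[OF oP]) (simp add: extend_by_zero_def dP)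
  then have "Ck_on k P ?f"
    using Ck_on_compose[OF oP img tr u(1)] by simp
  moreover have "Ck_on k Q ?f \<longleftrightarrow> Ck_on k Q (\<lambda>x. 0 :: real)"
  proof (rule Ck_on_cong[OF oQ])
    fix x assume "x \<in> Q"
    then have "chart_inv d x \<notin> L" using ch(2) by (auto simp: Q_def chart_inv_snd)
    then show "?f x = 0"
      using u(2)[of "snd c (chart_inv d x)"] chart_inv_snd[OF ch(1)]
      by (force simp: extend_by_zero_def L_def)
  qed
  then have "Ck_on k Q ?f" by (simp add: Ck_on_const)
  ultimately show "Ck_on k (snd d ` fst d) ?f"
    unfolding PQ by (rule Ck_on_Un[OF oP oQ])
qed

text \<open>The bump factor \<open>\<beta>\<close> turns the directional derivative along
  \<open>v\<close> in one chart into a global derivation. The value 0 off the smooth functions is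
  the convention of \<open>vector_fields\<close>.\<close>

definition coordinate_field ::
    "('a::topological_space, 'n::finite) chart set \<Rightarrow> ('a, 'n) chart
      \<Rightarrow> (real ^ 'n \<Rightarrow> real) \<Rightarrow> real ^ 'n \<Rightarrow> 'a vfield" where
  "coordinate_field \<A> c \<beta> v f = (if f \<in> smooth_functions \<A>
     then extend_by_zero c (\<lambda>x. \<beta> x * frechet_derivative (\<lambda>y. f (chart_inv c y)) (at x) v) else 0)"

text \<open>Smoothness of the values comes from extension by zero, as \<open>\<beta>\<close>
  vanishes off \<open>K\<close>. The derivation laws hold point by point: inside the chart by the
  rules for derivatives, outside because both sides vanish.\<close>

lemma coordinate_field_vector_field:
  fixes \<A> :: "('a::{t2_space, second_countable_topology}, 'n::finite) chart set"
  assumes \<A>: "smooth_atlas \<A>" and c: "c \<in> \<A>"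
    and K: "compact K" "K \<subseteq> snd c ` fst c"
    and \<beta>: "smooth_on UNIV \<beta>" "\<And>x. x \<notin> K \<Longrightarrow> \<beta> x = 0"
  shows "coordinate_field \<A> c \<beta> v \<in> vector_fields \<A>"
proof -
  note ch = smooth_atlas_chart[OF \<A> c]
  have der: "((\<lambda>y. f (chart_inv c y)) has_derivative
      frechet_derivative (\<lambda>y. f (chart_inv c y)) (at (snd c q))) (at (snd c q))"
    if "f \<in> smooth_functions \<A>" "q \<in> fst c" for f q
    using that c by (intro Ck_on_Suc_has_derivative[of 0 "snd c ` fst c"])
      (auto simp: smooth_functions_iff simp del: Ck_on.simps)
  let ?X = "coordinate_field \<A> c \<beta> v"
  have val: "?X f = (\<lambda>q. if q \<in> fst c then \<beta> (snd c q) *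
      frechet_derivative (\<lambda>y. f (chart_inv c y)) (at (snd c q)) v else 0)"
    if "f \<in> smooth_functions \<A>" for f
    using that by (simp add: coordinate_field_def extend_by_zero_def)
  have "?X f \<in> smooth_functions \<A>" if f: "f \<in> smooth_functions \<A>" for f
  proof -
    have "Ck_on (Suc k) (snd c ` fst c) (\<lambda>y. f (chart_inv c y))" for k
      using f c unfolding smooth_functions_iff by blast
    note Ck_on_Suc_derivative[OF this]
    moreover have "Ck_on k (snd c ` fst c) \<beta>" for k
      using \<beta>(1) Ck_on_subset[OF _ subset_UNIV] by (auto simp: smooth_on_def)
    ultimately have "extend_by_zero c (\<lambda>x. \<beta> x *
        frechet_derivative (\<lambda>y. f (chart_inv c y)) (at x) v) \<in> smooth_functions \<A>"
      using \<beta>(2) by (intro extend_by_zero_smooth[OF \<A> c K] Ck_on_mult open_chart_image[OF ch]) auto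
    with f show ?thesis by (simp add: coordinate_field_def)
  qed
  moreover have "?X (f + h) = ?X f + ?X h"
    if "f \<in> smooth_functions \<A>" "h \<in> smooth_functions \<A>" for f h
  proof
    fix q
    show "?X (f + h) q = (?X f + ?X h) q"
    proof (cases "q \<in> fst c")
      case True
      from frechet_derivative_eqI[OF has_derivative_add[OF der[OF that(1) True] der[OF that(2) True]], of v]
      show ?thesis using that by (simp add: val smooth_functions_add[OF \<A>] algebra_simps)
    qed (simp add: val smooth_functions_add[OF \<A>] that)
  qed
  moreover have "?X (f * h) = f * ?X h + h * ?X f"
    if "f \<in> smooth_functions \<A>" "h \<in> smooth_functions \<A>" for f h
  proof
    fix q
    show "?X (f * h) q = (f * ?X h + h * ?X f) q"
    proof (cases "q \<in> fst c")
      case True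
      from frechet_derivative_eqI[OF has_derivative_mult[OF der[OF that(1) True] der[OF that(2) True]], of v]
      show ?thesis using that True
        by (simp add: val smooth_functions_mult[OF \<A>] algebra_simps chart_inv_snd[OF ch])
    qed (simp add: val smooth_functions_mult[OF \<A>] that)
  qed
  moreover have "?X (\<lambda>p. r * f p) = (\<lambda>p. r * ?X f p)" if "f \<in> smooth_functions \<A>" for f r
  proof
    fix q
    have "(\<lambda>p. r * f p) \<in> smooth_functions \<A>"
      using smooth_functions_mult[OF \<A> smooth_functions_const[of r] that] by (simp add: times_fun_def)
    then show "?X (\<lambda>p. r * f p) q = r * ?X f q"
      using frechet_derivative_eqI[OF has_derivative_mult_right[OF der[OF that]], of q r v] that
      by (simp add: val)
  qed
  ultimately show ?thesis
    unfolding vector_fields_def by (auto simp: coordinate_field_def)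
qed

lemma local_frame_exists:
  fixes \<A> :: "('a::{t2_space, second_countable_topology}, 'n::finite) chart set"
  assumes \<A>: "smooth_atlas \<A>"
  obtains E :: "'n \<Rightarrow> 'a vfield" and x :: "'n \<Rightarrow> 'a \<Rightarrow> real" and r :: real
  where "r > 0" "\<And>i. E i \<in> vector_fields \<A>" "\<And>i. x i \<in> smooth_functions \<A>"
    "\<And>i j. E i (x j) p = (if i = j then r else 0)"
proof -
  obtain c where c: "c \<in> \<A>" "p \<in> fst c"
    using \<A> unfolding smooth_atlas_def by blast
  note ch = smooth_atlas_chart[OF \<A> c(1)]
  define x0 where "x0 = snd c p"
  have x0: "x0 \<in> snd c ` fst c" using c by (simp add: x0_def)
  obtain \<beta> :: "real ^ 'n \<Rightarrow> real" and K where \<beta>: "smooth_on UNIV \<beta>" "compact K" "K \<subseteq> snd c ` fst c"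
      "\<And>x. x \<notin> K \<Longrightarrow> \<beta> x = 0" "\<beta> x0 > 0"
    using smooth_bump_exists[OF open_chart_image[OF ch] x0] by blast
  \<comment> \<open>The coordinates are centred at \<open>x0\<close>: in the product rule the
    derivative of \<open>\<beta>\<close> is then multiplied by 0 at \<open>x0\<close>. One factor
    \<open>\<beta> x0\<close> comes from the function and one from the field, hence
    \<open>r = \<beta> x0 * \<beta> x0\<close>.\<close>
  define u where "u j y = \<beta> y * ((y + - x0) \<bullet> axis j 1)" for j y
  have Cu: "Ck_on k UNIV (u j)" for k j
    unfolding u_def using \<beta>(1)
    by (intro Ck_on_mult[OF open_UNIV] Ck_on_bounded_linear[OF open_UNIV bounded_linear_inner_left]
        Ck_on_add[OF open_UNIV Ck_on_ident[OF open_UNIV] Ck_on_const]) (simp add: smooth_on_def)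
  define x where "x j = extend_by_zero c (u j)" for j
  have x: "x j \<in> smooth_functions \<A>" for j
    unfolding x_def
  proof (rule extend_by_zero_smooth[OF \<A> c(1) \<beta>(2,3)])
    show "Ck_on k (snd c ` fst c) (u j)" for k by (rule Ck_on_subset[OF Cu subset_UNIV])
  qed (simp add: \<beta>(4) u_def)
  have "coordinate_field \<A> c \<beta> (axis i 1) (x j) p = (if i = j then \<beta> x0 * \<beta> x0 else 0)" for i j
  proof -
    have "(\<beta> has_derivative frechet_derivative \<beta> (at x0)) (at x0)"
      using \<beta>(1) unfolding smooth_on_def by (intro Ck_on_Suc_has_derivative[of 0 UNIV]) auto
    then have "(u j has_derivative (\<lambda>v. \<beta> x0 * (v \<bullet> axis j 1) +
        frechet_derivative \<beta> (at x0) v * ((x0 + - x0) \<bullet> axis j 1))) (at x0)"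
      unfolding u_def
      by (rule has_derivative_mult) (auto intro!: derivative_eq_intros)
    then have "((\<lambda>y. x j (chart_inv c y)) has_derivative (\<lambda>v. \<beta> x0 * (v \<bullet> axis j 1) +
        frechet_derivative \<beta> (at x0) v * ((x0 + - x0) \<bullet> axis j 1))) (at x0)"
    proof (rule has_derivative_transform_within_open[OF _ open_chart_image[OF ch] x0])
      show "u j y = x j (chart_inv c y)" if "y \<in> snd c ` fst c" for y
        using that by (simp add: x_def extend_by_zero_def chart_inv_mem snd_chart_inv)
    qed
    from frechet_derivative_eqI[OF this, of "axis i 1"] show ?thesis
      using x c(2) by (simp add: coordinate_field_def extend_by_zero_def x0_def[symmetric] inner_axis_axis)
  qed
  with that[of "\<beta> x0 * \<beta> x0" "\<lambda>i. coordinate_field \<A> c \<beta> (axis i 1)" x] show thesis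
    using \<beta> x coordinate_field_vector_field[OF \<A> c(1) \<beta>(2,3,1,4)] by simp
qed

lemma fscale_apply [simp]: "(h \<odot> X) f = h * X f"
  by (simp add: fscale_def)

lemma lie_bracket_swap: "lie_bracket Y X = - lie_bracket X Y"
  by (simp add: lie_bracket_def fun_eq_iff)

lemma one_form_zero:
  assumes "one_form \<A> \<alpha>" "0 \<in> vector_fields \<A>"
  shows "\<alpha> 0 = 0"
proof -
  have "\<alpha> (0 + 0) = \<alpha> 0 + \<alpha> 0" using assms unfolding one_form_def by blast
  then show ?thesis by simp
qed

section \<open>Kenmotsu manifolds\<close>

locale kenmotsu =
  fixes \<A> :: "('a::{t2_space, second_countable_topology}, 'n::finite) chart set"
    and \<phi> :: "'a vfield \<Rightarrow> 'a vfield" and \<xi> :: "'a vfield" and \<eta> :: "'a vfield \<Rightarrow> 'a \<Rightarrow> real"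
    and g :: "'a vfield \<Rightarrow> 'a vfield \<Rightarrow> 'a \<Rightarrow> real" and Dg :: "'a conn"
  assumes kenmotsu: "kenmotsu_manifold \<A> \<phi> \<xi> \<eta> g Dg"
begin

section \<open>The algebra of smooth functions and its module of vector fields\<close>

abbreviation "VF \<equiv> vector_fields \<A>"
abbreviation "SF \<equiv> smooth_functions \<A>"

lemma atlas: "smooth_atlas \<A>"
  using kenmotsu by (simp add: kenmotsu_manifold_def)

lemma SF_add [simp]: "f \<in> SF \<Longrightarrow> h \<in> SF \<Longrightarrow> f + h \<in> SF"
  by (rule smooth_functions_add[OF atlas])

lemma SF_mult [simp]: "f \<in> SF \<Longrightarrow> h \<in> SF \<Longrightarrow> f * h \<in> SF"
  by (rule smooth_functions_mult[OF atlas])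

lemma SF_zero [simp]: "0 \<in> SF"
  using smooth_functions_const[of 0] by (simp add: zero_fun_def)

lemma SF_one [simp]: "1 \<in> SF"
  using smooth_functions_const[of 1] by (simp add: one_fun_def)

lemma SF_uminus [simp]: "f \<in> SF \<Longrightarrow> - f \<in> SF"
  using SF_mult[OF smooth_functions_const[of "-1"], of f] by (simp add: times_fun_def fun_Compl_def)

lemma SF_diff [simp]: "f \<in> SF \<Longrightarrow> h \<in> SF \<Longrightarrow> f - h \<in> SF"
  using SF_add[of f "- h"] by simp

lemma SF_numeral [simp]: "numeral k \<in> SF"
  using smooth_functions_const[of "numeral k"] by (simp add: numeral_fun)

lemma VF_nonsmooth: "X \<in> VF \<Longrightarrow> f \<notin> SF \<Longrightarrow> X f = 0"
  and VF_smooth: "X \<in> VF \<Longrightarrow> f \<in> SF \<Longrightarrow> X f \<in> SF"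
  unfolding vector_fields_def by blast+

text \<open>Smoothness of \<open>f\<close> need not be assumed, since a field sends every other
  function to the smooth function 0.\<close>

lemma VF_SF [simp]: "X \<in> VF \<Longrightarrow> X f \<in> SF"
  by (metis SF_zero VF_nonsmooth VF_smooth)

lemma VF_apply_add: "X \<in> VF \<Longrightarrow> f \<in> SF \<Longrightarrow> h \<in> SF \<Longrightarrow> X (f + h) = X f + X h"
  unfolding vector_fields_def by blast

lemma VF_apply_mult: "X \<in> VF \<Longrightarrow> f \<in> SF \<Longrightarrow> h \<in> SF \<Longrightarrow> X (f * h) = f * X h + h * X f"
  unfolding vector_fields_def by blast

lemma VF_apply_cmult: "X \<in> VF \<Longrightarrow> f \<in> SF \<Longrightarrow> X (\<lambda>p. r * f p) = (\<lambda>p. r * X f p)"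
  unfolding vector_fields_def by blast

lemma VF_apply_zero: "X \<in> VF \<Longrightarrow> X 0 = 0"
  using VF_apply_add[of X 0 0] by simp

lemma VF_apply_uminus: "X \<in> VF \<Longrightarrow> f \<in> SF \<Longrightarrow> X (- f) = - X f"
  using VF_apply_cmult[of X f "-1"] by (simp add: fun_Compl_def)

lemma VF_apply_diff: "X \<in> VF \<Longrightarrow> f \<in> SF \<Longrightarrow> h \<in> SF \<Longrightarrow> X (f - h) = X f - X h"
  using VF_apply_add[of X f "- h"] VF_apply_uminus[of X h] by simp

lemma VF_I:
  assumes "\<And>f. f \<in> SF \<Longrightarrow> X f \<in> SF"
    and "\<And>f h. f \<in> SF \<Longrightarrow> h \<in> SF \<Longrightarrow> X (f + h) = X f + X h"
    and "\<And>f r. f \<in> SF \<Longrightarrow> X (\<lambda>p. r * f p) = (\<lambda>p. r * X f p)"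
    and "\<And>f h. f \<in> SF \<Longrightarrow> h \<in> SF \<Longrightarrow> X (f * h) = f * X h + h * X f"
    and "\<And>f. f \<notin> SF \<Longrightarrow> X f = 0"
  shows "X \<in> VF"
  unfolding vector_fields_def using assms by blast

lemma VF_zero [simp]: "0 \<in> VF"
proof (rule VF_I)
  show "(0 :: 'a vfield) (\<lambda>p. r * f p) = (\<lambda>p. r * (0 :: 'a vfield) f p)" for f r
    by (rule ext) simp
qed simp_all

lemma VF_add [simp]:
  assumes "X \<in> VF" "Y \<in> VF"
  shows "X + Y \<in> VF"
proof (rule VF_I)
  show "(X + Y) (\<lambda>p. r * f p) = (\<lambda>p. r * (X + Y) f p)" if "f \<in> SF" for f r
    by (rule ext) (simp add: assms that VF_apply_cmult distrib_left)
qed (simp_all add: assms VF_apply_add[of X] VF_apply_add[of Y] VF_apply_mult[of X] VF_apply_mult[of Y]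
    VF_nonsmooth[of X] VF_nonsmooth[of Y] algebra_simps)

lemma VF_scale [simp]:
  assumes "h \<in> SF" "X \<in> VF"
  shows "h \<odot> X \<in> VF"
proof (rule VF_I)
  show "(h \<odot> X) (\<lambda>p. r * f p) = (\<lambda>p. r * (h \<odot> X) f p)" if "f \<in> SF" for f r
    by (rule ext) (simp add: assms that VF_apply_cmult)
qed (simp_all add: assms VF_apply_add[of X] VF_apply_mult[of X] VF_nonsmooth[of X] algebra_simps)

lemma VF_uminus [simp]:
  assumes "X \<in> VF"
  shows "- X \<in> VF"
proof -
  have "- X = (- 1) \<odot> X" by (rule ext) simp
  with assms show ?thesis by simp
qed

lemma VF_diff [simp]: "X \<in> VF \<Longrightarrow> Y \<in> VF \<Longrightarrow> X - Y \<in> VF"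
  using VF_add[of X "- Y"] by simp

section \<open>Algebra of the almost contact metric structure\<close>

lemma riem: "riemannian_metric \<A> g" and lc: "levi_civita \<A> g Dg" and phi: "tensor_11 \<A> \<phi>"
  and eta_form: "one_form \<A> \<eta>" and xi [simp]: "\<xi> \<in> VF" and phi_xi: "\<phi> \<xi> = 0" and eta_xi: "\<eta> \<xi> = 1"
  using kenmotsu unfolding kenmotsu_manifold_def by blast+

lemma Dg_conn: "linear_connection \<A> Dg"
  using lc by (simp add: levi_civita_def)

lemma one_form_SF: "one_form \<A> \<alpha> \<Longrightarrow> X \<in> VF \<Longrightarrow> \<alpha> X \<in> SF"
  and one_form_add: "one_form \<A> \<alpha> \<Longrightarrow> X \<in> VF \<Longrightarrow> Y \<in> VF \<Longrightarrow> \<alpha> (X + Y) = \<alpha> X + \<alpha> Y"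
  and one_form_scale: "one_form \<A> \<alpha> \<Longrightarrow> h \<in> SF \<Longrightarrow> X \<in> VF \<Longrightarrow> \<alpha> (h \<odot> X) = h * \<alpha> X"
  unfolding one_form_def by blast+

lemma one_form_uminus: "one_form \<A> \<alpha> \<Longrightarrow> X \<in> VF \<Longrightarrow> \<alpha> (- X) = - \<alpha> X"
  using one_form_add[of \<alpha> X "- X"] one_form_zero[of \<A> \<alpha>] by (simp add: eq_neg_iff_add_eq_0 add.commute)

lemma one_form_diff: "one_form \<A> \<alpha> \<Longrightarrow> X \<in> VF \<Longrightarrow> Y \<in> VF \<Longrightarrow> \<alpha> (X - Y) = \<alpha> X - \<alpha> Y"
  using one_form_add[of \<alpha> X "- Y"] one_form_uminus[of \<alpha> Y] by simp

lemma g_form: "X \<in> VF \<Longrightarrow> one_form \<A> (g X)"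
  using riem by (simp add: riemannian_metric_def)

lemma g_sym: "X \<in> VF \<Longrightarrow> Y \<in> VF \<Longrightarrow> g X Y = g Y X"
  using riem by (simp add: riemannian_metric_def)

lemma g_SF [simp]: "X \<in> VF \<Longrightarrow> Y \<in> VF \<Longrightarrow> g X Y \<in> SF"
  using one_form_SF[OF g_form] by simp

lemma eta_SF [simp]: "X \<in> VF \<Longrightarrow> \<eta> X \<in> SF"
  by (rule one_form_SF[OF eta_form])

lemma g_zero_right: "V \<in> VF \<Longrightarrow> g V 0 = 0"
  using g_form[THEN one_form_zero] by simp

lemma g_right1:
  assumes [simp]: "V \<in> VF" "X \<in> VF"
  shows "g V (- X) = - g V X" "h \<in> SF \<Longrightarrow> g V (h \<odot> X) = h * g V X"
    "Y \<in> VF \<Longrightarrow> g V (X + Y) = g V X + g V Y" "Y \<in> VF \<Longrightarrow> g V (X - Y) = g V X - g V Y"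
  using g_form[OF assms(1), THEN one_form_uminus, of X]
    g_form[OF assms(1), THEN one_form_scale, of h X] g_form[OF assms(1), THEN one_form_add, of X Y]
    g_form[OF assms(1), THEN one_form_diff, of X Y]
  by simp_all

lemmas g_right = g_zero_right g_right1

lemma g_zero_left: "V \<in> VF \<Longrightarrow> g 0 V = 0"
  by (simp add: g_sym[of 0] g_zero_right)

lemma g_left1:
  assumes [simp]: "V \<in> VF" "X \<in> VF"
  shows "g (- X) V = - g X V" "h \<in> SF \<Longrightarrow> g (h \<odot> X) V = h * g X V"
    "Y \<in> VF \<Longrightarrow> g (X + Y) V = g X V + g Y V" "Y \<in> VF \<Longrightarrow> g (X - Y) V = g X V - g Y V"
  by (simp_all add: g_sym[of _ V] g_right)

lemmas g_left = g_zero_left g_left1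

lemmas eta_lin = one_form_zero[OF eta_form VF_zero] one_form_uminus[OF eta_form]
  one_form_scale[OF eta_form] one_form_add[OF eta_form] one_form_diff[OF eta_form]

lemma phi_VF [simp]: "X \<in> VF \<Longrightarrow> \<phi> X \<in> VF"
  and phi_add: "X \<in> VF \<Longrightarrow> Y \<in> VF \<Longrightarrow> \<phi> (X + Y) = \<phi> X + \<phi> Y"
  and phi_scale: "h \<in> SF \<Longrightarrow> X \<in> VF \<Longrightarrow> \<phi> (h \<odot> X) = h \<odot> \<phi> X"
  using phi unfolding tensor_11_def by blast+

lemma phi_zero: "\<phi> 0 = 0"
  using phi_add[of 0 0] by simp

lemma phi_uminus: "X \<in> VF \<Longrightarrow> \<phi> (- X) = - \<phi> X"
  using phi_add[of X "- X"] by (simp add: phi_zero eq_neg_iff_add_eq_0 add.commute)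

lemma phi_diff: "X \<in> VF \<Longrightarrow> Y \<in> VF \<Longrightarrow> \<phi> (X - Y) = \<phi> X - \<phi> Y"
  using phi_add[of X "- Y"] by (simp add: phi_uminus)

lemmas phi_lin = phi_zero phi_uminus phi_scale phi_add phi_diff

lemma phi_phi: "X \<in> VF \<Longrightarrow> \<phi> (\<phi> X) = - X + \<eta> X \<odot> \<xi>"
  and eta_phi: "X \<in> VF \<Longrightarrow> \<eta> (\<phi> X) = 0"
  and g_phi_phi: "X \<in> VF \<Longrightarrow> Y \<in> VF \<Longrightarrow> g (\<phi> X) (\<phi> Y) = g X Y - \<eta> X * \<eta> Y"
  and Dg_xi: "X \<in> VF \<Longrightarrow> Dg X \<xi> = X - \<eta> X \<odot> \<xi>"
  using kenmotsu unfolding kenmotsu_manifold_def by blast+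

lemma Dg_phi:
  assumes "X \<in> VF" "Y \<in> VF"
  shows "Dg X (\<phi> Y) = \<phi> (Dg X Y) + (g (\<phi> X) Y \<odot> \<xi> - \<eta> Y \<odot> \<phi> X)"
proof -
  have "cov_deriv_11 Dg \<phi> X Y = g (\<phi> X) Y \<odot> \<xi> - \<eta> Y \<odot> \<phi> X"
    using kenmotsu assms unfolding kenmotsu_manifold_def by blast
  then show ?thesis unfolding cov_deriv_11_def by (simp only: diff_eq_eq add.commute)
qed

text \<open>Since \<open>\<phi> \<xi> = 0\<close>, the left-hand side of the compatibility of
  \<open>g\<close> and \<open>\<phi>\<close> vanishes when \<open>\<xi>\<close> is its first
  argument.\<close>

lemma g_xi_left: "X \<in> VF \<Longrightarrow> g \<xi> X = \<eta> X"
  using g_phi_phi[of \<xi> X] by (simp add: phi_xi eta_xi g_zero_left)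

lemma g_xi_right: "X \<in> VF \<Longrightarrow> g X \<xi> = \<eta> X"
  using g_xi_left g_sym[of X \<xi>] by simp

text \<open>The fundamental 2-form of the structure.\<close>

definition \<omega> :: "'a vfield \<Rightarrow> 'a vfield \<Rightarrow> 'a \<Rightarrow> real" where "\<omega> X Y = g (\<phi> X) Y"

lemma omega_SF [simp]: "X \<in> VF \<Longrightarrow> Y \<in> VF \<Longrightarrow> \<omega> X Y \<in> SF"
  by (simp add: \<omega>_def)

text \<open>Compatibility applied to \<open>\<phi> X\<close> and \<open>Y\<close> gives
  \<open>g (\<phi> (\<phi> X)) (\<phi> Y) = g (\<phi> X) Y\<close>. The \<open>\<xi>\<close> part of
  \<open>\<phi> (\<phi> X)\<close> drops out, because \<open>\<xi>\<close> is orthogonal to the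
  image of \<open>\<phi>\<close>.\<close>

lemma omega_skew: "X \<in> VF \<Longrightarrow> Y \<in> VF \<Longrightarrow> \<omega> X Y = - \<omega> Y X"
  using g_phi_phi[of "\<phi> X" Y]
  by (simp add: \<omega>_def phi_phi eta_phi g_left g_xi_left g_sym[of X])

lemma omega_self: "X \<in> VF \<Longrightarrow> \<omega> X X = 0"
  using omega_skew[of X X] by (simp add: fun_eq_iff)

lemma omega_xi: "X \<in> VF \<Longrightarrow> \<omega> X \<xi> = 0" "X \<in> VF \<Longrightarrow> \<omega> \<xi> X = 0"
  by (simp_all add: \<omega>_def g_xi_right eta_phi phi_xi g_zero_left)

lemma omega_zero: "V \<in> VF \<Longrightarrow> \<omega> 0 V = 0" "V \<in> VF \<Longrightarrow> \<omega> V 0 = 0"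
  by (simp_all add: \<omega>_def phi_zero g_zero_left g_zero_right)

lemma omega_left1:
  assumes [simp]: "V \<in> VF" "X \<in> VF"
  shows "\<omega> (- X) V = - \<omega> X V" "h \<in> SF \<Longrightarrow> \<omega> (h \<odot> X) V = h * \<omega> X V"
    "Y \<in> VF \<Longrightarrow> \<omega> (X + Y) V = \<omega> X V + \<omega> Y V" "Y \<in> VF \<Longrightarrow> \<omega> (X - Y) V = \<omega> X V - \<omega> Y V"
  by (simp_all add: \<omega>_def phi_lin g_left g_zero_left)

lemma omega_right1:
  assumes [simp]: "V \<in> VF" "X \<in> VF"
  shows "\<omega> V (- X) = - \<omega> V X" "h \<in> SF \<Longrightarrow> \<omega> V (h \<odot> X) = h * \<omega> V X"
    "Y \<in> VF \<Longrightarrow> \<omega> V (X + Y) = \<omega> V X + \<omega> V Y" "Y \<in> VF \<Longrightarrow> \<omega> V (X - Y) = \<omega> V X - \<omega> V Y"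
  by (simp_all add: \<omega>_def g_right)

lemmas omega_left = omega_zero(1) omega_left1
lemmas omega_right = omega_zero(2) omega_right1

section \<open>Calculus of the Levi-Civita connection\<close>

lemma Dg_VF [simp]: "X \<in> VF \<Longrightarrow> Y \<in> VF \<Longrightarrow> Dg X Y \<in> VF"
  and Dg_add_left: "X \<in> VF \<Longrightarrow> Y \<in> VF \<Longrightarrow> Z \<in> VF \<Longrightarrow> Dg (X + Y) Z = Dg X Z + Dg Y Z"
  and Dg_add: "X \<in> VF \<Longrightarrow> Y \<in> VF \<Longrightarrow> Z \<in> VF \<Longrightarrow> Dg X (Y + Z) = Dg X Y + Dg X Z"
  and Dg_scale: "h \<in> SF \<Longrightarrow> X \<in> VF \<Longrightarrow> Y \<in> VF \<Longrightarrow> Dg X (h \<odot> Y) = X h \<odot> Y + h \<odot> Dg X Y"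
  using Dg_conn unfolding linear_connection_def by blast+

lemma Dg_zero: "X \<in> VF \<Longrightarrow> Dg X 0 = 0" and Dg_zero_left: "X \<in> VF \<Longrightarrow> Dg 0 X = 0"
  using Dg_add[of X 0 0] Dg_add_left[of 0 0 X] by simp_all

lemma Dg_uminus: "X \<in> VF \<Longrightarrow> Y \<in> VF \<Longrightarrow> Dg X (- Y) = - Dg X Y"
  and Dg_uminus_left: "X \<in> VF \<Longrightarrow> Y \<in> VF \<Longrightarrow> Dg (- X) Y = - Dg X Y"
  using Dg_add[of X Y "- Y"] Dg_add_left[of X "- X" Y]
  by (simp_all add: Dg_zero Dg_zero_left eq_neg_iff_add_eq_0 add.commute)

lemma Dg_diff: "X \<in> VF \<Longrightarrow> Y \<in> VF \<Longrightarrow> Z \<in> VF \<Longrightarrow> Dg X (Y - Z) = Dg X Y - Dg X Z"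
  using Dg_add[of X Y "- Z"] by (simp add: Dg_uminus)

lemmas Dg_lin = Dg_zero Dg_uminus Dg_scale Dg_add Dg_diff Dg_zero_left Dg_uminus_left

lemma lie_bracket_Dg: "X \<in> VF \<Longrightarrow> Y \<in> VF \<Longrightarrow> lie_bracket X Y = Dg X Y - Dg Y X"
  using lc unfolding levi_civita_def by simp

lemma Dg_metric: "X \<in> VF \<Longrightarrow> Y \<in> VF \<Longrightarrow> Z \<in> VF \<Longrightarrow> X (g Y Z) = g (Dg X Y) Z + g Y (Dg X Z)"
  using lc unfolding levi_civita_def by blast

lemma lie_bracket_VF [simp]: "X \<in> VF \<Longrightarrow> Y \<in> VF \<Longrightarrow> lie_bracket X Y \<in> VF"
  by (simp add: lie_bracket_Dg)

text \<open>Metric compatibility applied to \<open>\<eta> Y = g Y \<xi>\<close>, with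
  \<open>Dg X \<xi>\<close> known; the bracketed term is the covariant derivative of
  \<open>\<eta>\<close>.\<close>

lemma VF_apply_eta:
  "X \<in> VF \<Longrightarrow> Y \<in> VF \<Longrightarrow> X (\<eta> Y) = \<eta> (Dg X Y) + (g X Y - \<eta> X * \<eta> Y)"
  using Dg_metric[of X Y \<xi>]
  by (simp add: g_xi_right Dg_xi g_right g_sym[of Y X])

text \<open>Metric compatibility applied to \<open>g (\<phi> Y) Z\<close>; the bracketed term is the
  covariant derivative of \<open>\<omega>\<close>, inherited from that of
  \<open>\<phi>\<close>.\<close>

lemma VF_apply_omega:
  "X \<in> VF \<Longrightarrow> Y \<in> VF \<Longrightarrow> Z \<in> VF \<Longrightarrow>
    X (\<omega> Y Z) = \<omega> (Dg X Y) Z + \<omega> Y (Dg X Z) + (\<omega> X Y * \<eta> Z - \<eta> Y * \<omega> X Z)"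
  using Dg_metric[of X "\<phi> Y" Z]
  by (simp add: \<omega>_def Dg_phi g_left g_xi_left)

text \<open>Test with \<open>V = U\<close>: a nonzero value of \<open>U\<close> occurs only on a
  smooth function, so positivity of \<open>g\<close> would apply at that point.\<close>

lemma metric_nondegenerate:
  assumes "U \<in> VF" "\<And>V. V \<in> VF \<Longrightarrow> g U V = 0"
  shows "U = 0"
proof (intro ext)
  fix f p
  show "U f p = 0 f p"
  proof (rule ccontr)
    assume *: "U f p \<noteq> 0 f p"
    then have "f \<in> SF" using VF_nonsmooth[OF assms(1), of f] by (metis zero_fun_apply)
    with * riem assms have "g U U p > 0" by (auto simp: riemannian_metric_def)
    with assms show False by simp
  qed
qed

section \<open>Curvature of the Levi-Civita connection\<close>

lemma jacobi:
  assumes [simp]: "X \<in> VF" "Y \<in> VF" "Z \<in> VF"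
  shows "lie_bracket X (lie_bracket Y Z) + lie_bracket Y (lie_bracket Z X)
    + lie_bracket Z (lie_bracket X Y) = 0"
  by (rule ext) (simp add: lie_bracket_def VF_apply_diff[of X] VF_apply_diff[of Y] VF_apply_diff[of Z])

lemma curvature_Dg_VF [simp]:
  "X \<in> VF \<Longrightarrow> Y \<in> VF \<Longrightarrow> Z \<in> VF \<Longrightarrow> curvature Dg X Y Z \<in> VF"
  by (simp add: curvature_def)

lemma curvature_Dg_swap:
  "X \<in> VF \<Longrightarrow> Y \<in> VF \<Longrightarrow> Z \<in> VF \<Longrightarrow> curvature Dg Y X Z = - curvature Dg X Y Z"
  by (simp add: curvature_def lie_bracket_swap[of Y X] Dg_lin)

text \<open>Torsion-freeness is used twice: once to expand each bracket inside a derivative, and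
  once to turn \<open>Dg U [V, W] - Dg [V, W] U\<close> into a double bracket. The cyclic sum then
  reduces to the Jacobi identity.\<close>

lemma bianchi:
  assumes [simp]: "X \<in> VF" "Y \<in> VF" "Z \<in> VF"
  shows "curvature Dg X Y Z + curvature Dg Y Z X + curvature Dg Z X Y = 0"
proof -
  have *: "Dg U (lie_bracket V W) - Dg (lie_bracket V W) U = lie_bracket U (lie_bracket V W)"
    if "U \<in> VF" "V \<in> VF" "W \<in> VF" for U V W
    using that lie_bracket_Dg[of U "lie_bracket V W"] by simp
  have **: "Dg U (lie_bracket V W) = Dg U (Dg V W) - Dg U (Dg W V)"
    if "U \<in> VF" "V \<in> VF" "W \<in> VF" for U V W
    using that by (simp add: lie_bracket_Dg Dg_lin)
  show ?thesis
    using jacobi[OF assms] *[OF assms(1,2,3)] *[OF assms(2,3,1)] *[OF assms(3,1,2)]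
      **[OF assms(1,2,3)] **[OF assms(2,3,1)] **[OF assms(3,1,2)]
    unfolding curvature_def by (simp add: algebra_simps)
qed

text \<open>Both sides of \<open>[X, Y] = XY - YX\<close> are applied to the function
  \<open>g Z W\<close> and expanded by metric compatibility; the mixed first-order terms
  cancel.\<close>

lemma curvature_Dg_skew:
  assumes [simp]: "X \<in> VF" "Y \<in> VF" "Z \<in> VF" "W \<in> VF"
  shows "g (curvature Dg X Y Z) W = - g (curvature Dg X Y W) Z"
proof -
  have "lie_bracket X Y (g Z W) = X (Y (g Z W)) - Y (X (g Z W))"
    by (simp add: lie_bracket_def)
  then show ?thesis
    by (simp add: Dg_metric[of X] Dg_metric[of Y] Dg_metric[of "lie_bracket X Y"] VF_apply_add[of X] VF_apply_add[of Y] curvature_def g_left)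
      (simp add: g_sym[of Z] g_sym[of "Dg Y Z"] g_sym[of "Dg X Z"] algebra_simps)
qed

lemma curvature_Dg_xi:
  assumes [simp]: "X \<in> VF" "Y \<in> VF"
  shows "curvature Dg X Y \<xi> = \<eta> X \<odot> Y - \<eta> Y \<odot> X"
  by (rule ext) (simp add: curvature_def Dg_xi Dg_lin lie_bracket_Dg eta_lin VF_apply_eta[of X] VF_apply_eta[of Y]
      g_sym[of Y X] algebra_simps)

text \<open>A trilinear form that is symmetric in its first two and skew in its last two arguments
  vanishes; \<open>T\<close> below is such a form.\<close>

lemma g_curvature_Dg_xi_left:
  assumes [simp]: "Z \<in> VF" "W \<in> VF" "V \<in> VF"
  shows "g (curvature Dg \<xi> Z W) V = \<eta> W * g Z V - g Z W * \<eta> V"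
proof -
  define T where "T Z W V = g (curvature Dg \<xi> Z W) V - (\<eta> W * g Z V - g Z W * \<eta> V)" for Z W V
  have skew: "T Z W V = - T Z V W" if "Z \<in> VF" "W \<in> VF" "V \<in> VF" for Z W V
    using that curvature_Dg_skew[of \<xi> Z W V] by (simp add: T_def)
  \<comment> \<open>In the Bianchi identity for \<open>\<xi>, Z, W\<close> the term with
    \<open>\<xi>\<close> in the last slot is already known, so it fixes the antisymmetric part in
    \<open>Z\<close> and \<open>W\<close>.\<close>
  have sym: "T Z W V = T W Z V" if [simp]: "Z \<in> VF" "W \<in> VF" "V \<in> VF" for Z W V
  proof -
    have "g (curvature Dg \<xi> Z W + curvature Dg Z W \<xi> + curvature Dg W \<xi> Z) V = 0"
      using bianchi[of \<xi> Z W] g_zero_left[of V] by simp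
    then show ?thesis
      by (simp add: T_def curvature_Dg_xi curvature_Dg_swap[of \<xi> W] g_left g_sym[of W Z] algebra_simps)
  qed
  \<comment> \<open>Six alternating exchanges lead back to the original order of the arguments, with
    an odd number of sign changes.\<close>
  have "T Z W V = - T Z W V"
    using sym[of Z W V] skew[of W Z V] sym[of W V Z] skew[of V W Z] sym[of V Z W] skew[of Z V W]
    by simp
  then have "T Z W V x = - T Z W V x" for x
    by (metis fun_Compl_def)
  then have "T Z W V x = 0" for x
    by (simp only: equal_neg_zero)
  then show ?thesis by (simp add: T_def fun_eq_iff)
qed

lemma curvature_Dg_xi_left:
  assumes [simp]: "Z \<in> VF" "W \<in> VF"
  shows "curvature Dg \<xi> Z W = \<eta> W \<odot> Z - g Z W \<odot> \<xi>"
proof -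
  have "curvature Dg \<xi> Z W - (\<eta> W \<odot> Z - g Z W \<odot> \<xi>) = 0"
    by (rule metric_nondegenerate) (simp_all add: g_left g_curvature_Dg_xi_left g_xi_left)
  then show ?thesis by simp
qed

subsection \<open>The semi-symmetric non-metric connection\<close>

definition nabla :: "'a conn" where "nabla = ssnm_connection \<phi> \<xi> g Dg"

lemma nabla: "nabla X Y = Dg X Y + \<omega> X Y \<odot> \<xi>"
  by (simp add: nabla_def ssnm_connection_def \<omega>_def)

lemma nabla_VF [simp]: "X \<in> VF \<Longrightarrow> Y \<in> VF \<Longrightarrow> nabla X Y \<in> VF"
  by (simp add: nabla)

text \<open>Substitute \<open>nabla X Y = Dg X Y + \<omega> X Y \<odot> \<xi>\<close>. In the
  \<open>\<xi>\<close> component all derivatives of the arguments cancel, as do the terms with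
  \<open>\<eta> X\<close> and \<open>\<eta> Y\<close>; the skew term
  \<open>\<omega> X Y * \<eta> Z\<close> from the derivative of \<open>\<omega>\<close> is
  doubled.\<close>

lemma curvature_nabla:
  assumes [simp]: "X \<in> VF" "Y \<in> VF" "Z \<in> VF"
  shows "curvature nabla X Y Z = curvature Dg X Y Z + \<omega> Y Z \<odot> X - \<omega> X Z \<odot> Y
    + ((\<omega> X Y + \<omega> X Y) * \<eta> Z) \<odot> \<xi>"
  by (rule ext)
    (simp add: curvature_def nabla Dg_lin Dg_xi VF_apply_omega[of X] VF_apply_omega[of Y] omega_right omega_left omega_xi
      lie_bracket_Dg[of X Y] omega_skew[of Y X] algebra_simps)

lemma curvature_nabla_xi:
  assumes [simp]: "X \<in> VF" "Y \<in> VF"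
  shows "curvature nabla X Y \<xi> = \<eta> X \<odot> Y - \<eta> Y \<odot> X + (\<omega> X Y + \<omega> X Y) \<odot> \<xi>"
  by (rule ext) (simp add: curvature_nabla curvature_Dg_xi omega_xi eta_xi)

lemma curvature_nabla_xi_left:
  assumes [simp]: "Y \<in> VF" "Z \<in> VF"
  shows "curvature nabla \<xi> Y Z = \<eta> Z \<odot> Y + (\<omega> Y Z - g Y Z) \<odot> \<xi>"
  by (rule ext) (simp add: curvature_nabla curvature_Dg_xi_left omega_xi algebra_simps)

text \<open>The candidates are the horizontal projections of a local frame: in dimension at least 2
  they cannot all vanish at \<open>p\<close>.\<close>

lemma horizontal_nonzero_exists:
  assumes "CARD('n) > 1"
  obtains Y where "Y \<in> VF" "\<eta> Y = 0" "g Y Y p > 0"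
proof -
  obtain E :: "'n \<Rightarrow> 'a vfield" and x :: "'n \<Rightarrow> 'a \<Rightarrow> real" and r :: real
    where r: "r > 0" and E: "\<And>i. E i \<in> VF" and x: "\<And>i. x i \<in> SF"
      and Ex: "\<And>i j. E i (x j) p = (if i = j then r else 0)"
    by (rule local_frame_exists[OF atlas, where p = p]) (rule that, assumption+)
  define Y where "Y i = E i - \<eta> (E i) \<odot> \<xi>" for i
  have Y: "Y i \<in> VF" "\<eta> (Y i) = 0" for i
    using E by (simp_all add: Y_def eta_lin eta_xi)
  have Yx: "Y i (x j) p = (if i = j then r else 0) - \<eta> (E i) p * \<xi> (x j) p" for i j
    by (simp add: Y_def Ex)
  obtain i j :: 'n where "i \<noteq> j"
    using assms by (metis (full_types) UNIV_I card_1_singleton_iff less_irrefl One_nat_def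
        card_le_Suc0_iff_eq finite not_less)
  \<comment> \<open>Otherwise \<open>r\<close> times the identity matrix would equal a matrix of
    rank at most one. Two diagonal entries and one off-diagonal entry suffice for the
    contradiction.\<close>
  have "\<exists>k l. Y k (x l) p \<noteq> 0"
  proof (rule ccontr)
    assume "\<not> (\<exists>k l. Y k (x l) p \<noteq> 0)"
    then have *: "(if k = l then r else 0) = \<eta> (E k) p * \<xi> (x l) p" for k l
      using Yx[of k l] by simp
    show False
      using *[of i i] *[of i j] *[of j j] \<open>i \<noteq> j\<close> r by auto
  qed
  then obtain k l where "Y k (x l) p \<noteq> 0" by blast
  then have "g (Y k) (Y k) p > 0"
    using riem Y x unfolding riemannian_metric_def by blast
  with that Y show thesis by blast
qed

lemma g_phi_self: "X \<in> VF \<Longrightarrow> \<eta> X = 0 \<Longrightarrow> g (\<phi> X) (\<phi> X) = g X X"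
  by (simp add: g_phi_phi)

lemma g_phi_orthogonal: "X \<in> VF \<Longrightarrow> g (\<phi> X) X = 0"
  using omega_self[of X] by (simp add: \<omega>_def)

section \<open>Values of the new connection and its curvature at \<open>0\<close> and
  \<open>\<xi>\<close>\<close>

lemma nabla_zero: "X \<in> VF \<Longrightarrow> nabla X 0 = 0"
  by (rule ext) (simp add: nabla Dg_lin omega_right)

lemma nabla_uminus: "X \<in> VF \<Longrightarrow> Y \<in> VF \<Longrightarrow> nabla X (- Y) = - nabla X Y"
  by (rule ext) (simp add: nabla Dg_lin omega_right)

lemma nabla_xi: "X \<in> VF \<Longrightarrow> nabla X \<xi> = X - \<eta> X \<odot> \<xi>"
  by (rule ext) (simp add: nabla Dg_xi omega_xi)

lemma nabla_xi_xi: "nabla \<xi> \<xi> = 0"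
  by (rule ext) (simp add: nabla_xi eta_xi)

lemma nabla_scale_xi: "X \<in> VF \<Longrightarrow> h \<in> SF \<Longrightarrow> nabla X (h \<odot> \<xi>) = X h \<odot> \<xi> + h \<odot> (X - \<eta> X \<odot> \<xi>)"
  by (rule ext) (simp add: nabla Dg_lin Dg_xi omega_right omega_xi)

lemma curvature_nabla_VF [simp]:
  "X \<in> VF \<Longrightarrow> Y \<in> VF \<Longrightarrow> Z \<in> VF \<Longrightarrow> curvature nabla X Y Z \<in> VF"
  by (simp add: curvature_def)

lemma curvature_nabla_zero: "X \<in> VF \<Longrightarrow> Y \<in> VF \<Longrightarrow> curvature nabla X Y 0 = 0"
  by (simp add: curvature_def nabla_zero)

lemma curvature_nabla_zero_left: "Y \<in> VF \<Longrightarrow> Z \<in> VF \<Longrightarrow> curvature nabla 0 Y Z = 0"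
  and curvature_nabla_zero_middle: "X \<in> VF \<Longrightarrow> Z \<in> VF \<Longrightarrow> curvature nabla X 0 Z = 0"
proof -
  have *: "nabla 0 W = 0" if "W \<in> VF" for W
    by (rule ext) (simp add: that nabla Dg_lin omega_left)
  show "Y \<in> VF \<Longrightarrow> Z \<in> VF \<Longrightarrow> curvature nabla 0 Y Z = 0"
    by (rule ext) (simp add: curvature_def * nabla_zero lie_bracket_Dg Dg_lin)
  show "X \<in> VF \<Longrightarrow> Z \<in> VF \<Longrightarrow> curvature nabla X 0 Z = 0"
    by (rule ext) (simp add: curvature_def * nabla_zero lie_bracket_Dg Dg_lin)
qed

text \<open>A horizontal \<open>V\<close> is orthogonal to \<open>\<xi>\<close>, so the pairing
  removes the \<open>\<omega>\<close> term.\<close>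

lemma g_curvature_nabla_xi:
  assumes "X \<in> VF" "Y \<in> VF" "V \<in> VF" "\<eta> V = 0"
  shows "g (curvature nabla X Y \<xi>) V = \<eta> X * g Y V - \<eta> Y * g X V"
  using assms by (simp add: curvature_nabla_xi g_left g_xi_left)

lemma g_curvature_nabla_xi_left:
  assumes "Z \<in> VF" "W \<in> VF" "V \<in> VF" "\<eta> V = 0"
  shows "g (curvature nabla \<xi> Z W) V = \<eta> W * g Z V"
  using assms by (simp add: curvature_nabla_xi_left g_left g_xi_left)

end

section \<open>Weak symmetry\<close>

locale weakly_symmetric_kenmotsu = kenmotsu \<A> \<phi> \<xi> \<eta> g Dg
  for \<A> :: "('a::{t2_space, second_countable_topology}, 'n::finite) chart set"
    and \<phi> :: "'a vfield \<Rightarrow> 'a vfield" and \<xi> :: "'a vfield" and \<eta> :: "'a vfield \<Rightarrow> 'a \<Rightarrow> real"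
    and g :: "'a vfield \<Rightarrow> 'a vfield \<Rightarrow> 'a \<Rightarrow> real" and Dg :: "'a conn" +
  fixes A B C D :: "'a vfield \<Rightarrow> 'a \<Rightarrow> real" and \<sigma> :: "'a vfield"
  assumes weak: "weakly_symmetric \<A> g (ssnm_connection \<phi> \<xi> g Dg) A B C D \<sigma>"
begin

lemma forms: "one_form \<A> A" "one_form \<A> B" "one_form \<A> C" "one_form \<A> D"
  and sigma [simp]: "\<sigma> \<in> VF"
  using weak unfolding weakly_symmetric_def by blast+

lemmas forms_SF [simp] = forms[THEN one_form_SF]

text \<open>Pairing with \<open>V\<close> gives an identity of functions, in which a horizontal
  \<open>V\<close> suppresses every \<open>\<xi>\<close> component.\<close>

lemma g_weakly_symmetric:
  assumes [simp]: "X \<in> VF" "Y \<in> VF" "Z \<in> VF" "W \<in> VF" "V \<in> VF"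
  shows "g (nabla X (curvature nabla Y Z W)) V - g (curvature nabla (nabla X Y) Z W) V
      - g (curvature nabla Y (nabla X Z) W) V - g (curvature nabla Y Z (nabla X W)) V =
    A X * g (curvature nabla Y Z W) V + B Y * g (curvature nabla X Z W) V
      + C Z * g (curvature nabla Y X W) V + D W * g (curvature nabla Y Z X) V
      + g (curvature nabla Y Z W) X * g \<sigma> V"
proof -
  have "cov_deriv_13 nabla (curvature nabla) X Y Z W =
      A X \<odot> curvature nabla Y Z W + B Y \<odot> curvature nabla X Z W + C Z \<odot> curvature nabla Y X W
      + D W \<odot> curvature nabla Y Z X + g (curvature nabla Y Z W) X \<odot> \<sigma>"
    using weak assms unfolding weakly_symmetric_def nabla_def by blast
  from arg_cong[OF this, of "\<lambda>U. g U V"] show ?thesis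
    by (simp add: cov_deriv_13_def g_left)
qed

text \<open>\<open>\<xi>\<close> goes into the slots \<open>X\<close>, \<open>Z\<close> and
  \<open>W\<close>. On the left the first two terms cancel and the others contain
  \<open>nabla \<xi> \<xi> = 0\<close>. On the right the \<open>B\<close> term has the curvature of
  \<open>\<xi>, \<xi>\<close>, and the \<open>\<sigma>\<close> term the factor
  \<open>- \<eta> Y = 0\<close>.\<close>

lemma sum_forms_xi:
  assumes [simp]: "Y \<in> VF" "V \<in> VF" and [simp]: "\<eta> Y = 0" "\<eta> V = 0"
  shows "(A \<xi> + C \<xi> + D \<xi>) * g Y V = 0"
proof -
  have [simp]: "curvature nabla Y \<xi> \<xi> = - Y"
    by (rule ext) (simp add: curvature_nabla_xi eta_xi omega_xi)
  show ?thesis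
    using g_weakly_symmetric[of \<xi> Y \<xi> \<xi> V]
    by (simp add: nabla_xi_xi curvature_nabla_zero curvature_nabla_zero_middle nabla_uminus
        g_curvature_nabla_xi eta_xi eta_lin g_left g_xi_left g_xi_right algebra_simps)
qed

text \<open>\<open>\<xi>\<close> goes into the slots \<open>Y\<close> and \<open>W\<close>. For
  horizontal \<open>X\<close>, \<open>nabla X \<xi> = X\<close>; the first and third terms on the
  left are both \<open>g (nabla X Z) V\<close>, and the other two vanish. The \<open>B\<close> and
  \<open>D\<close> terms vanish for the same reason.\<close>

lemma forms_horizontal:
  assumes [simp]: "X \<in> VF" "Z \<in> VF" "V \<in> VF" and [simp]: "\<eta> X = 0" "\<eta> Z = 0" "\<eta> V = 0"
  shows "A X * g Z V + C Z * g X V + g X Z * g \<sigma> V = 0"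
proof -
  have [simp]: "curvature nabla \<xi> Z \<xi> = Z"
    by (rule ext) (simp add: curvature_nabla_xi eta_xi omega_xi)
  show ?thesis
    using g_weakly_symmetric[of X \<xi> Z \<xi> V]
    by (simp add: nabla_xi g_curvature_nabla_xi g_curvature_nabla_xi_left eta_xi
        eta_lin g_xi_left g_sym[of Z X] algebra_simps)
qed

text \<open>\<open>\<xi>\<close> goes into the slots \<open>X\<close> and \<open>Y\<close>. The
  curvature of \<open>\<xi>, Z\<close> on \<open>W\<close> is then a multiple of
  \<open>\<xi>\<close>, orthogonal to \<open>V\<close> but visible to the \<open>\<sigma>\<close>
  term.\<close>

lemma D_horizontal:
  assumes [simp]: "Z \<in> VF" "W \<in> VF" "V \<in> VF" and [simp]: "\<eta> Z = 0" "\<eta> W = 0" "\<eta> V = 0"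
  shows "D W * g Z V + (\<omega> Z W - g Z W) * g \<sigma> V = 0"
proof -
  have [simp]: "curvature nabla \<xi> Z W = (\<omega> Z W - g Z W) \<odot> \<xi>"
    by (rule ext) (simp add: curvature_nabla_xi_left)
  \<comment> \<open>Differentiating \<open>\<eta> W = 0\<close> along \<open>\<xi>\<close> shows
    that \<open>W\<close> stays horizontal, which removes the last term on the left.\<close>
  have "\<eta> (Dg \<xi> W) = 0"
    using VF_apply_eta[of \<xi> W] by (simp add: VF_apply_zero[of \<xi>] g_xi_left)
  then have [simp]: "\<eta> (nabla \<xi> W) = 0"
    by (simp add: nabla eta_lin omega_xi)
  show ?thesis
    using g_weakly_symmetric[of \<xi> \<xi> Z W V]
    by (simp add: nabla_xi_xi nabla_scale_xi curvature_nabla_zero_left g_curvature_nabla_xi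
        g_curvature_nabla_xi_left eta_xi eta_lin g_left g_xi_left g_xi_right algebra_simps)
qed

lemma sum_forms_vanishes:
  assumes "CARD('n) > 1" and X: "X \<in> VF"
  shows "A X p + C X p + D X p = 0"
proof -
  obtain Y where Y [simp]: "Y \<in> VF" "\<eta> Y = 0" and N: "g Y Y p > 0"
    by (rule horizontal_nonzero_exists[OF assms(1), where p = p])
  \<comment> \<open>\<open>\<phi> Y\<close> is horizontal, orthogonal to \<open>Y\<close> and of the
    same length, hence a second independent horizontal direction at \<open>p\<close>.\<close>
  define Y' where "Y' = \<phi> Y"
  have Y' [simp]: "Y' \<in> VF" "\<eta> Y' = 0"
    by (simp_all add: Y'_def eta_phi)
  have N': "g Y' Y' p > 0" and ort [simp]: "g Y Y' = 0" "g Y' Y = 0"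
    using N by (simp_all add: Y'_def g_phi_self g_sym[of Y "\<phi> Y"] g_phi_orthogonal)
  have E2: "A U p * g Z V p + C Z p * g U V p + g U Z p * g \<sigma> V p = 0"
    if "U \<in> VF" "Z \<in> VF" "V \<in> VF" "\<eta> U = 0" "\<eta> Z = 0" "\<eta> V = 0" for U Z V
    using fun_cong[OF forms_horizontal[OF that], of p] by simp
  \<comment> \<open>Each triple puts \<open>Y\<close> in one slot and \<open>Y'\<close> in the other
    two; orthogonality leaves a single term, a multiple of \<open>g Y' Y' p\<close>.\<close>
  have AY: "A Y p = 0" and CY: "C Y p = 0" and sY: "g \<sigma> Y p = 0"
    using E2[of Y Y' Y'] E2[of Y' Y Y'] E2[of Y' Y' Y] N N' by simp_all
  have hor: "A U p + C U p + D U p = 0" if U: "U \<in> VF" "\<eta> U = 0" for U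
  proof -
    \<comment> \<open>With \<open>Y\<close> in the two remaining slots, the other two terms carry
      factors just shown to vanish, whatever \<open>g U Y p\<close> is.\<close>
    have "A U p = 0" "C U p = 0"
      using E2[of U Y Y] E2[of Y U Y] U N AY CY sY by simp_all
    moreover have "D U p = 0"
      using fun_cong[OF D_horizontal[of Y U Y], of p] U N sY by simp
    ultimately show ?thesis by simp
  qed
  have ver: "A \<xi> p + C \<xi> p + D \<xi> p = 0"
    using fun_cong[OF sum_forms_xi[of Y Y], of p] N by simp
  \<comment> \<open>The horizontal part of \<open>X\<close>: the sum of the forms is linear over
    functions, so its vanishing on \<open>H\<close> and on \<open>\<xi>\<close> suffices.\<close>
  define H where "H = X - \<eta> X \<odot> \<xi>"
  have H: "H \<in> VF" "\<eta> H = 0" using X by (simp_all add: H_def eta_lin eta_xi)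
  have split: "\<alpha> X p = \<alpha> H p + \<eta> X p * \<alpha> \<xi> p" if "one_form \<A> \<alpha>" for \<alpha>
    using one_form_diff[OF that, of X "\<eta> X \<odot> \<xi>"] one_form_scale[OF that, of "\<eta> X" \<xi>] X
    by (simp add: H_def)
  have "A X p + C X p + D X p = (A H p + C H p + D H p) + \<eta> X p * (A \<xi> p + C \<xi> p + D \<xi> p)"
    using split[OF forms(1)] split[OF forms(3)] split[OF forms(4)] by (simp add: algebra_simps)
  with hor[OF H] ver show ?thesis by simp
qed

end

theorem theorem5p5:
  fixes \<A> :: "('a::{t2_space, second_countable_topology}, 'n::finite) chart set"
    and \<phi> :: "'a vfield \<Rightarrow> 'a vfield" and \<xi> \<sigma> :: "'a vfield"
    and \<eta> A B C D :: "'a vfield \<Rightarrow> 'a \<Rightarrow> real"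
    and g :: "'a vfield \<Rightarrow> 'a vfield \<Rightarrow> 'a \<Rightarrow> real"
    and Dg :: "'a conn"
  assumes "CARD('n) > 3"
    and "kenmotsu_manifold \<A> \<phi> \<xi> \<eta> g Dg"
    and "weakly_symmetric \<A> g (ssnm_connection \<phi> \<xi> g Dg) A B C D \<sigma>"
  shows "\<forall>X\<in>vector_fields \<A>. \<forall>p. A X p + C X p + D X p = 0"
proof -
  interpret weakly_symmetric_kenmotsu \<A> \<phi> \<xi> \<eta> g Dg A B C D \<sigma>
    using assms(2,3) by unfold_locales
  show ?thesis using sum_forms_vanishes assms(1) by simp
qed

end
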